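(* Let $f_h^n=\sum_{j=1}^N f_j^n\psi_j\in\mathcal V_h$ be given, let the time step $\tau_n$ satisfy the CFL condition $$\tau_n=\mathrm{cfl}\,\min_{i=1,\dots,N}\frac{m_i}{\sum_{j\in\mathcal I(i),\,j\ne i}d_{ij}^{\mathsf L,n}},\qquad 0<\mathrm{cfl}\le\tfrac12,$$ and let $f_i^{n+1}$ be defined by the convex limiting update $$m_if_i^{n+1}=m_if_i^{\mathsf L,n+1}+\sum_{j\in\mathcal I(i)}\ell_{ij}A_{ij}^{n+1},\qquad i=1,\dots,N,$$ where $f_i^{\mathsf L,n+1}$, $A_{ij}^{n+1}$ and $\ell_{ij}$ are the low-order solution, the correction coefficients and the limiter coefficients defined in the context. Then the total mass is conserved, i.e. $$\sum_{i=1}^N m_if_i^{n+1}=\sum_{i=1}^N m_if_i^n,$$ and the method preserves the discrete maximum principle $$\min_{j\in\mathcal I(i)}f_j^n\;\le\;f_i^{n+1}\;\le\;\max_{j\in\mathcal I(i)}f_j^n,\qquad i=1,\dots,N.$$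
   Context: Setting. $\Omega=\Omega_{\boldsymbol x}\times\Omega_{\boldsymbol v}$ is a phase-space domain of dimension $d=d_x+d_v$, with periodic boundary conditions on $\Omega$, and $\nabla=(\nabla_{\boldsymbol x},\nabla_{\boldsymbol v})^{\mathsf T}$. One approximates $\partial_t f+\boldsymbol\beta\cdot\nabla f=0$, where $\boldsymbol\beta=(\boldsymbol v,\boldsymbol E+\boldsymbol v\times\boldsymbol B)^{\mathsf T}$ with $\boldsymbol E=\boldsymbol E(\boldsymbol x,t)$, $\boldsymbol B=\boldsymbol B(\boldsymbol x,t)$. At time $t^n$ the discrete velocity field is $\boldsymbol\beta_h^n=(\boldsymbol v,\boldsymbol E_h^n+\boldsymbol v\times\boldsymbol B_h^n)^{\mathsf T}$, where $\boldsymbol E_h^n,\boldsymbol B_h^n$ are given finite element fields depending on $\boldsymbol x$ only; it satisfies $\nabla\cdot\boldsymbol\beta_h^n\equiv0$. Finite element space. $\mathcal T_{\boldsymbol x}$ and $\mathcal T_{\boldsymbol v}$ are meshes of $\Omega_{\boldsymbol x}$ and $\Omega_{\boldsymbol v}$ made of cuboids; $\mathcal V_{\boldsymbol x}$ and $\mathcal V_{\boldsymbol v}$ are the spaces of continuous functions which on every cell are polynomials of degree at most one in each variable ($\mathbb Q_1$ elements), with nodal bases $\{\phi_i\}_{i=1}^{N_x}$ and $\{\varphi_j\}_{j=1}^{N_v}$. Then $\mathcal V_h=\mathcal V_{\boldsymbol x}\otimes\mathcal V_{\boldsymbol v}$, with nodal basis $\{\psi_i\}_{i=1}^N$, $N=N_xN_v$,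 $\psi_{(i-1)N_v+j}=\phi_i\varphi_j$. $\mathcal I(i)$ denotes the set of (indices of) all nodes within the support of $\psi_i$ (so $i\in\mathcal I(i)$), and $\mathrm{card}(\mathcal I(i))$ its cardinality. $(\cdot,\cdot)$ is the $L^2(\Omega)$ inner product. Low-order scheme. $m_{ij}=(\psi_j,\psi_i)$, $m_i=\sum_{j\in\mathcal I(i)}m_{ij}$, $c_{ij}^n=(\boldsymbol\beta_h^n\cdot\nabla\psi_j,\psi_i)$, $$d_{ij}^{\mathsf L,n}=\max(|c_{ij}^n|,|c_{ji}^n|)\ (j\ne i),\qquad d_{ii}^{\mathsf L,n}=-\sum_{j\in\mathcal I(i),\,j\ne i}d_{ij}^{\mathsf L,n},$$ $$m_i\frac{f_i^{\mathsf L,n+1}-f_i^n}{\tau_n}+\sum_{j\in\mathcal I(i)}c_{ij}^nf_j^n-\sum_{j\in\mathcal I(i)}d_{ij}^{\mathsf L,n}f_j^n=0,\quad i=1,\dots,N.$$ High-order scheme. Let $\widetilde{\mathcal V}_h$ be an auxiliary finite element space (same polynomial type as $\mathcal V_h$, on a coarser mesh) with basis $\{\widetilde\psi_i\}_{i=1}^{\widetilde N}$ and lumped masses $\widetilde m_i$, and $I_h:\widetilde{\mathcal V}_h\to\mathcal V_h$ a linear interpolation operator. Define $\widetilde R_{1,h}^n\in\widetilde{\mathcal V}_h$ and $R_{2,h}^n\in\mathcal V_h$ by their nodal values $\widetilde R_{1,i}^n=\widetilde m_i^{-1}(\boldsymbol\beta_h^n\cdot\nabla f_h^n,\widetilde\psi_i)$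 and $R_{2,i}^n=m_i^{-1}(\boldsymbol\beta_h^n\cdot\nabla f_h^n,\psi_i)$, and set $R_h^n=I_h(\widetilde R_{1,h}^n)-R_{2,h}^n$, with nodal values $R_i^n$. With $n(f_h^n)=\max\big(\|f_h^n-\mathrm{mean}(f_h^n)\|_{L^\infty(\Omega)},10^{-14}\|f_h^n\|_{L^\infty(\Omega)}\big)$ set $$d_{ij}^{\mathsf R,n}=m_{ij}\frac{\max(|R_i^n|,|R_j^n|)}{n(f_h^n)},\qquad d_{ij}^{\mathsf H,n}=\min(d_{ij}^{\mathsf L,n},d_{ij}^{\mathsf R,n})\ (j\ne i),\qquad d_{ii}^{\mathsf H,n}=-\sum_{j\in\mathcal I(i),\,j\ne i}d_{ij}^{\mathsf H,n}.$$ The high-order solution $(f_j^{\mathsf H,n+1})_{j=1}^N$ solves $$\sum_{j\in\mathcal I(i)}m_{ij}f_j^{\mathsf H,n+1}=\sum_{j\in\mathcal I(i)}m_{ij}f_j^n-\tau_n\sum_{j\in\mathcal I(i)}c_{ij}^nf_j^n+\tau_n\sum_{j\in\mathcal I(i)}d_{ij}^{\mathsf H,n}f_j^n,\quad i=1,\dots,N.$$ Limiter. For $j\in\mathcal I(i)$, $$A_{ij}^{n+1}=m_{ij}\big((f_i^{\mathsf H,n+1}-f_i^n)-(f_j^{\mathsf H,n+1}-f_j^n)\big)+\tau_n(d_{ij}^{\mathsf H,n}-d_{ij}^{\mathsf L,n})(f_j^n-f_i^n).$$ For $j\in\mathcal I(i)\setminus\{i\}$ put $\lambda_j(i)=\frac1{\mathrm{card}(\mathcal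 I(i))-1}$ and $P_{ij}^{n+1}=\frac{1}{\lambda_j(i)m_i}A_{ij}^{n+1}$. Let $f_i^{n,\max}=\max_{j\in\mathcal I(i)}f_j^n$, $f_i^{n,\min}=\min_{j\in\mathcal I(i)}f_j^n$, $\epsilon_i=10^{-14}\max_{k=1,\dots,N}|f_k^n|$, and $$\ell_j^i=\begin{cases}\min\Big(\dfrac{|f_i^{n,\min}-f_i^{\mathsf L,n+1}|}{|P_{ij}^{n+1}|+\epsilon_i},1\Big)&\text{if } f_i^{\mathsf L,n+1}+P_{ij}^{n+1}<f_i^{n,\min},\\[2mm]1&\text{if } f_i^{n,\min}\le f_i^{\mathsf L,n+1}+P_{ij}^{n+1}\le f_i^{n,\max},\\[1mm]\min\Big(\dfrac{|f_i^{n,\max}-f_i^{\mathsf L,n+1}|}{|P_{ij}^{n+1}|+\epsilon_i},1\Big)&\text{if } f_i^{n,\max}<f_i^{\mathsf L,n+1}+P_{ij}^{n+1}.\end{cases}$$ Finally $\ell_{ij}=\min(\ell_j^i,\ell_i^j)$ for $j\neq i$ (the value of $\ell_{ii}$ is irrelevant since $A_{ii}^{n+1}=0$). It is implicit that $f_h^n$ is not identically zero, so that $n(f_h^n)>0$. *)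

theory Defs
  imports "HOL-Analysis.Analysis" "HOL-Probability.Essential_Supremum"
begin

text \<open>
  Periodic boundary conditions: functions on the box \<open>cbox a b\<close> with opposite faces identified are
  represented by their periodic extensions to the whole space.
\<close>

definition periods :: "real^'n \<Rightarrow> real^'n \<Rightarrow> (real^'n) set" where
  "periods a b = {\<chi> k. of_int (z k) * (b $ k - a $ k) | z :: 'n \<Rightarrow> int. True}"

definition periodic_cells :: "real^'n \<Rightarrow> real^'n \<Rightarrow> (real^'n) set set \<Rightarrow> (real^'n) set set" where
  "periodic_cells a b T = {(+) p ` K | p K. p \<in> periods a b \<and> K \<in> T}"

text \<open>
  The last clause says that the mesh has no hanging nodes, also across the periodic boundary: two
  cells of the periodically extended mesh meet in a common (possibly empty) face.
\<close>

definition periodic_cuboid_mesh :: "real^'n \<Rightarrow> real^'n \<Rightarrow> (real^'n) set set \<Rightarrow> bool" where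
  "periodic_cuboid_mesh a b T \<longleftrightarrow>
     (\<forall>k. a $ k < b $ k) \<and> T division_of cbox a b \<and> (\<forall>K\<in>T. interior K \<noteq> {}) \<and>
     (\<forall>K\<in>periodic_cells a b T. \<forall>L\<in>periodic_cells a b T. (K \<inter> L) face_of K)"

definition mesh_size :: "(real^'n) set set \<Rightarrow> real" where
  "mesh_size T = Max (diameter ` T)"

text \<open>The nodes are the cell vertices, one representative modulo the periods.\<close>

definition mesh_nodes :: "real^'n \<Rightarrow> real^'n \<Rightarrow> (real^'n) set set \<Rightarrow> (real^'n) set" where
  "mesh_nodes a b T =
     {x. (\<forall>k. a $ k \<le> x $ k \<and> x $ k < b $ k) \<and> (\<exists>K\<in>T. x extreme_point_of K)}"

definition q1_on :: "(real^'n) set \<Rightarrow> (real^'n \<Rightarrow> real) \<Rightarrow> bool" where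
  "q1_on K w \<longleftrightarrow>
     (\<exists>c :: 'n set \<Rightarrow> real. \<forall>x\<in>K. w x = (\<Sum>S\<in>UNIV. c S * (\<Prod>k\<in>S. x $ k)))"

definition q1_space :: "real^'n \<Rightarrow> real^'n \<Rightarrow> (real^'n) set set \<Rightarrow> (real^'n \<Rightarrow> real) set" where
  "q1_space a b T =
     {w. continuous_on UNIV w \<and> (\<forall>p\<in>periods a b. \<forall>x. w (x + p) = w x) \<and> (\<forall>K\<in>T. q1_on K w)}"

text \<open>
  A finite element space given by its domain and its nodal basis; the degrees of freedom are
  numbered \<open>1, \<dots>, ndof\<close>.
\<close>

record 'a fe_space =
  fe_dom :: "'a set"
  ndof :: nat
  node :: "nat \<Rightarrow> 'a"
  shape :: "nat \<Rightarrow> 'a \<Rightarrow> real"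

definition fe_fun :: "'a fe_space \<Rightarrow> (nat \<Rightarrow> real) \<Rightarrow> 'a \<Rightarrow> real" where
  "fe_fun W f = (\<lambda>y. \<Sum>j=1..ndof W. f j * shape W j y)"

definition q1_nodal ::
  "real^'n \<Rightarrow> real^'n \<Rightarrow> (real^'n) set set \<Rightarrow> (real^'n) fe_space \<Rightarrow> bool" where
  "q1_nodal a b T X \<longleftrightarrow>
     fe_dom X = cbox a b \<and>
     bij_betw (node X) {1..ndof X} (mesh_nodes a b T) \<and>
     (\<forall>i\<in>{1..ndof X}. \<forall>j\<in>{1..ndof X}. shape X i (node X j) = (if i = j then 1 else 0)) \<and>
     (\<forall>i\<in>{1..ndof X}. shape X i \<in> q1_space a b T) \<and>
     (\<forall>w\<in>q1_space a b T. \<exists>c. w = fe_fun X c)"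

definition tensor_space :: "('a \<Rightarrow> real) set \<Rightarrow> ('b \<Rightarrow> real) set \<Rightarrow> ('a \<times> 'b \<Rightarrow> real) set" where
  "tensor_space U V =
     {w. \<exists>(n::nat) u v. (\<forall>k<n. u k \<in> U \<and> v k \<in> V) \<and> w = (\<lambda>(x, y). \<Sum>k<n. u k x * v k y)}"

text \<open>
  Degree of freedom \<open>(i - 1) N\<^sub>v + j\<close> of the tensor product space belongs to the pair \<open>(i, j)\<close>,
  with \<open>1 \<le> i \<le> N\<^sub>x\<close> and \<open>1 \<le> j \<le> N\<^sub>v\<close>.
\<close>

definition tensor_fe :: "'a fe_space \<Rightarrow> 'b fe_space \<Rightarrow> ('a \<times> 'b) fe_space" where
  "tensor_fe X V =
     \<lparr> fe_dom = fe_dom X \<times> fe_dom V,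
       ndof = ndof X * ndof V,
       node = (\<lambda>k. (node X ((k - 1) div ndof V + 1), node V ((k - 1) mod ndof V + 1))),
       shape = (\<lambda>k (x, v). shape X ((k - 1) div ndof V + 1) x * shape V ((k - 1) mod ndof V + 1) v) \<rparr>"

definition linear_between ::
  "('a \<Rightarrow> real) set \<Rightarrow> ('b \<Rightarrow> real) set \<Rightarrow> (('a \<Rightarrow> real) \<Rightarrow> 'b \<Rightarrow> real) \<Rightarrow> bool" where
  "linear_between U W F \<longleftrightarrow>
     (\<forall>u\<in>U. F u \<in> W) \<and>
     (\<forall>u\<in>U. \<forall>v\<in>U. F (\<lambda>y. u y + v y) = (\<lambda>y. F u y + F v y)) \<and>
     (\<forall>u\<in>U. \<forall>r. F (\<lambda>y. r * u y) = (\<lambda>y. r * F u y))"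

definition piecewise_polynomial :: "(real^'n) set set \<Rightarrow> (real^'n \<Rightarrow> real^'m) \<Rightarrow> bool" where
  "piecewise_polynomial T E \<longleftrightarrow>
     (\<forall>K\<in>T. \<exists>p. polynomial_function p \<and> (\<forall>x\<in>interior K. E x = p x))"

text \<open>
  The phase space velocity \<open>(v, E + v \<times> B)\<close>, including the reduced models with fewer than three
  dimensions. The velocity coordinate \<open>k\<close> is identified with coordinate \<open>\<iota> k\<close> of the
  three-dimensional space, where the cross product lives, and the position coordinate \<open>k\<close> is
  transported by the velocity coordinate \<open>\<sigma> k\<close>. For \<open>d\<^sub>x = d\<^sub>v = 3\<close> both maps are bijections; a
  smaller example is \<open>d\<^sub>x = 1\<close>, \<open>d\<^sub>v = 2\<close> with \<open>v = (v\<^sub>1, v\<^sub>2, 0)\<close>.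
\<close>

definition embed3 :: "('v \<Rightarrow> 3) \<Rightarrow> real^'v \<Rightarrow> real^3" where
  "embed3 \<iota> v = (\<Sum>k\<in>UNIV. v $ k *\<^sub>R axis (\<iota> k) 1)"

definition phase_velocity ::
  "('x \<Rightarrow> 'v) \<Rightarrow> ('v \<Rightarrow> 3) \<Rightarrow> (real^'x \<Rightarrow> real^'v) \<Rightarrow> (real^'x \<Rightarrow> real^3) \<Rightarrow>
   (real^'x) \<times> (real^'v) \<Rightarrow> (real^'x) \<times> (real^'v)" where
  "phase_velocity \<sigma> \<iota> E B =
     (\<lambda>(x, v). (\<chi> k. v $ \<sigma> k, E x + (\<chi> k. cross3 (embed3 \<iota> v) (B x) $ \<iota> k)))"

lemma phase_velocity_divergence_free:
  fixes x :: "real^'x" and v :: "real^'v"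
  shows "(\<Sum>k\<in>UNIV. deriv (\<lambda>s. fst (phase_velocity \<sigma> \<iota> E B (x + s *\<^sub>R axis k 1, v)) $ k) 0) +
         (\<Sum>k\<in>UNIV. deriv (\<lambda>s. snd (phase_velocity \<sigma> \<iota> E B (x, v + s *\<^sub>R axis k 1)) $ k) 0) = 0"
proof -
  have e: "embed3 \<iota> (v + s *\<^sub>R axis k 1) = embed3 \<iota> v + s *\<^sub>R axis (\<iota> k) 1" for s :: real and k :: 'v
  proof -
    have "(\<Sum>j\<in>UNIV. (s * axis k 1 $ j) *\<^sub>R axis (\<iota> j) (1::real)) =
          (\<Sum>j\<in>UNIV. if j = k then s *\<^sub>R axis (\<iota> k) 1 else 0)"
      by (intro sum.cong) (auto simp: axis_def)
    then show ?thesis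
      by (simp add: embed3_def scaleR_add_left sum.distrib)
  qed
  have z: "cross3 (axis m 1) C $ m = 0" for m and C :: "real^3"
    using dot_cross_self(1)[of "axis m 1" C] by (simp add: inner_axis')
  have "snd (phase_velocity \<sigma> \<iota> E B (x, v + s *\<^sub>R axis k 1)) $ k =
        snd (phase_velocity \<sigma> \<iota> E B (x, v)) $ k" for s k
    by (simp add: phase_velocity_def e cross_add_left cross_mult_left z)
  moreover have "fst (phase_velocity \<sigma> \<iota> E B (x + s *\<^sub>R axis k 1, v)) $ k =
        fst (phase_velocity \<sigma> \<iota> E B (x, v)) $ k" for s k
    by (simp add: phase_velocity_def)
  ultimately show ?thesis
    by simp
qed

text \<open>
  Finite element functions are differentiable off the cell faces. On this null set the value of
  \<open>grad\<close> is arbitrary; it only enters under integrals.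
\<close>

definition grad :: "('a::euclidean_space \<Rightarrow> real) \<Rightarrow> 'a \<Rightarrow> 'a" where
  "grad w y = (\<Sum>e\<in>Basis. frechet_derivative w (at y) e *\<^sub>R e)"

definition advect :: "('a::euclidean_space \<Rightarrow> 'a) \<Rightarrow> ('a \<Rightarrow> real) \<Rightarrow> 'a \<Rightarrow> real" where
  "advect \<beta> w y = \<beta> y \<bullet> grad w y"

definition l2 :: "'a::euclidean_space set \<Rightarrow> ('a \<Rightarrow> real) \<Rightarrow> ('a \<Rightarrow> real) \<Rightarrow> real" where
  "l2 \<Omega> u w = (LINT y:\<Omega>|lebesgue. u y * w y)"

definition linf_norm :: "'a::euclidean_space set \<Rightarrow> ('a \<Rightarrow> real) \<Rightarrow> real" where
  "linf_norm \<Omega> w = real_of_ereal (esssup (lebesgue_on \<Omega>) (\<lambda>y. ereal \<bar>w y\<bar>))"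

definition mean :: "'a::euclidean_space set \<Rightarrow> ('a \<Rightarrow> real) \<Rightarrow> real" where
  "mean \<Omega> w = (LINT y:\<Omega>|lebesgue. w y) / measure lebesgue \<Omega>"

text \<open>The closure is taken for the periodic extension, hence it is the support on the torus.\<close>

definition stencil :: "'a::euclidean_space fe_space \<Rightarrow> nat \<Rightarrow> nat set" where
  "stencil W i = {j \<in> {1..ndof W}. node W j \<in> closure {y. shape W i y \<noteq> 0}}"

definition mass :: "'a::euclidean_space fe_space \<Rightarrow> nat \<Rightarrow> nat \<Rightarrow> real" where
  "mass W i j = l2 (fe_dom W) (shape W j) (shape W i)"

definition lumped_mass :: "'a::euclidean_space fe_space \<Rightarrow> nat \<Rightarrow> real" where
  "lumped_mass W i = (\<Sum>j\<in>stencil W i. mass W i j)"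

definition conv :: "'a::euclidean_space fe_space \<Rightarrow> ('a \<Rightarrow> 'a) \<Rightarrow> nat \<Rightarrow> nat \<Rightarrow> real" where
  "conv W \<beta> i j = l2 (fe_dom W) (advect \<beta> (shape W j)) (shape W i)"

definition with_diagonal ::
  "'a::euclidean_space fe_space \<Rightarrow> (nat \<Rightarrow> nat \<Rightarrow> real) \<Rightarrow> nat \<Rightarrow> nat \<Rightarrow> real" where
  "with_diagonal W d i j = (if j = i then - (\<Sum>k\<in>stencil W i - {i}. d i k) else d i j)"

definition visc_low :: "'a::euclidean_space fe_space \<Rightarrow> ('a \<Rightarrow> 'a) \<Rightarrow> nat \<Rightarrow> nat \<Rightarrow> real" where
  "visc_low W \<beta> = with_diagonal W (\<lambda>i j. max \<bar>conv W \<beta> i j\<bar> \<bar>conv W \<beta> j i\<bar>)"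

definition low_order_solution ::
  "'a::euclidean_space fe_space \<Rightarrow> ('a \<Rightarrow> 'a) \<Rightarrow> real \<Rightarrow> (nat \<Rightarrow> real) \<Rightarrow> (nat \<Rightarrow> real) \<Rightarrow> bool" where
  "low_order_solution W \<beta> \<tau> f fL \<longleftrightarrow>
     (\<forall>i\<in>{1..ndof W}.
        lumped_mass W i * ((fL i - f i) / \<tau>) + (\<Sum>j\<in>stencil W i. conv W \<beta> i j * f j)
          - (\<Sum>j\<in>stencil W i. visc_low W \<beta> i j * f j) = 0)"

definition lumped_advection ::
  "'a::euclidean_space fe_space \<Rightarrow> ('a \<Rightarrow> 'a) \<Rightarrow> ('a \<Rightarrow> real) \<Rightarrow> 'a \<Rightarrow> real" where
  "lumped_advection W \<beta> w =
     fe_fun W (\<lambda>i. l2 (fe_dom W) (advect \<beta> w) (shape W i) / lumped_mass W i)"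

definition residual ::
  "'a::euclidean_space fe_space \<Rightarrow> 'a fe_space \<Rightarrow> (('a \<Rightarrow> real) \<Rightarrow> 'a \<Rightarrow> real) \<Rightarrow> ('a \<Rightarrow> 'a) \<Rightarrow>
   (nat \<Rightarrow> real) \<Rightarrow> nat \<Rightarrow> real" where
  "residual W W' Ih \<beta> f i =
     Ih (lumped_advection W' \<beta> (fe_fun W f)) (node W i)
       - lumped_advection W \<beta> (fe_fun W f) (node W i)"

definition normalization_factor :: "'a::euclidean_space set \<Rightarrow> ('a \<Rightarrow> real) \<Rightarrow> real" where
  "normalization_factor \<Omega> w =
     max (linf_norm \<Omega> (\<lambda>y. w y - mean \<Omega> w)) (1 / 10 ^ 14 * linf_norm \<Omega> w)"

definition visc_res ::
  "'a::euclidean_space fe_space \<Rightarrow> 'a fe_space \<Rightarrow> (('a \<Rightarrow> real) \<Rightarrow> 'a \<Rightarrow> real) \<Rightarrow> ('a \<Rightarrow> 'a) \<Rightarrow>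
   (nat \<Rightarrow> real) \<Rightarrow> nat \<Rightarrow> nat \<Rightarrow> real" where
  "visc_res W W' Ih \<beta> f i j =
     mass W i j * (max \<bar>residual W W' Ih \<beta> f i\<bar> \<bar>residual W W' Ih \<beta> f j\<bar>
       / normalization_factor (fe_dom W) (fe_fun W f))"

definition visc_high ::
  "'a::euclidean_space fe_space \<Rightarrow> 'a fe_space \<Rightarrow> (('a \<Rightarrow> real) \<Rightarrow> 'a \<Rightarrow> real) \<Rightarrow> ('a \<Rightarrow> 'a) \<Rightarrow>
   (nat \<Rightarrow> real) \<Rightarrow> nat \<Rightarrow> nat \<Rightarrow> real" where
  "visc_high W W' Ih \<beta> f =
     with_diagonal W (\<lambda>i j. min (visc_low W \<beta> i j) (visc_res W W' Ih \<beta> f i j))"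

definition high_order_solution ::
  "'a::euclidean_space fe_space \<Rightarrow> 'a fe_space \<Rightarrow> (('a \<Rightarrow> real) \<Rightarrow> 'a \<Rightarrow> real) \<Rightarrow> ('a \<Rightarrow> 'a) \<Rightarrow>
   real \<Rightarrow> (nat \<Rightarrow> real) \<Rightarrow> (nat \<Rightarrow> real) \<Rightarrow> bool" where
  "high_order_solution W W' Ih \<beta> \<tau> f fH \<longleftrightarrow>
     (\<forall>i\<in>{1..ndof W}.
        (\<Sum>j\<in>stencil W i. mass W i j * fH j) =
        (\<Sum>j\<in>stencil W i. mass W i j * f j)
          - \<tau> * (\<Sum>j\<in>stencil W i. conv W \<beta> i j * f j)
          + \<tau> * (\<Sum>j\<in>stencil W i. visc_high W W' Ih \<beta> f i j * f j))"

definition correction ::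
  "'a::euclidean_space fe_space \<Rightarrow> 'a fe_space \<Rightarrow> (('a \<Rightarrow> real) \<Rightarrow> 'a \<Rightarrow> real) \<Rightarrow> ('a \<Rightarrow> 'a) \<Rightarrow>
   real \<Rightarrow> (nat \<Rightarrow> real) \<Rightarrow> (nat \<Rightarrow> real) \<Rightarrow> nat \<Rightarrow> nat \<Rightarrow> real" where
  "correction W W' Ih \<beta> \<tau> f fH i j =
     mass W i j * ((fH i - f i) - (fH j - f j))
       + \<tau> * (visc_high W W' Ih \<beta> f i j - visc_low W \<beta> i j) * (f j - f i)"

definition local_max :: "'a::euclidean_space fe_space \<Rightarrow> (nat \<Rightarrow> real) \<Rightarrow> nat \<Rightarrow> real" where
  "local_max W f i = Max (f ` stencil W i)"

definition local_min :: "'a::euclidean_space fe_space \<Rightarrow> (nat \<Rightarrow> real) \<Rightarrow> nat \<Rightarrow> real" where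
  "local_min W f i = Min (f ` stencil W i)"

text \<open>In the next three definitions \<open>A\<close> stands for the matrix of correction coefficients.\<close>

definition scaled_correction ::
  "'a::euclidean_space fe_space \<Rightarrow> (nat \<Rightarrow> nat \<Rightarrow> real) \<Rightarrow> nat \<Rightarrow> nat \<Rightarrow> real" where
  "scaled_correction W A i j =
     (let lam = 1 / (real (card (stencil W i)) - 1) in 1 / (lam * lumped_mass W i) * A i j)"

definition one_sided_limiter ::
  "'a::euclidean_space fe_space \<Rightarrow> (nat \<Rightarrow> real) \<Rightarrow> (nat \<Rightarrow> real) \<Rightarrow> (nat \<Rightarrow> nat \<Rightarrow> real) \<Rightarrow>
   nat \<Rightarrow> nat \<Rightarrow> real" where
  "one_sided_limiter W f fL A i j =
     (let P = scaled_correction W A i j;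
          \<epsilon> = 1 / 10 ^ 14 * Max ((\<lambda>k. \<bar>f k\<bar>) ` {1..ndof W})
      in if fL i + P < local_min W f i then min (\<bar>local_min W f i - fL i\<bar> / (\<bar>P\<bar> + \<epsilon>)) 1
         else if fL i + P \<le> local_max W f i then 1
         else min (\<bar>local_max W f i - fL i\<bar> / (\<bar>P\<bar> + \<epsilon>)) 1)"

text \<open>Only \<open>j \<noteq> i\<close> matters here: the diagonal correction coefficients vanish.\<close>

definition limiter ::
  "'a::euclidean_space fe_space \<Rightarrow> (nat \<Rightarrow> real) \<Rightarrow> (nat \<Rightarrow> real) \<Rightarrow> (nat \<Rightarrow> nat \<Rightarrow> real) \<Rightarrow>
   nat \<Rightarrow> nat \<Rightarrow> real" where
  "limiter W f fL A i j = min (one_sided_limiter W f fL A i j) (one_sided_limiter W f fL A j i)"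

text \<open>
  The CFL condition is stated in the extended reals, where \<open>m / 0 = \<infinity>\<close> for \<open>m > 0\<close>: nodes without
  viscosity do not restrict the time step. (In the reals \<open>m / 0 = 0\<close> would force \<open>\<tau> = 0\<close>.)
\<close>

definition cfl_condition :: "'a::euclidean_space fe_space \<Rightarrow> ('a \<Rightarrow> 'a) \<Rightarrow> real \<Rightarrow> real \<Rightarrow> bool" where
  "cfl_condition W \<beta> cfl \<tau> \<longleftrightarrow>
     ereal \<tau> = ereal cfl *
       Min ((\<lambda>i. ereal (lumped_mass W i) / ereal (\<Sum>j\<in>stencil W i - {i}. visc_low W \<beta> i j))
              ` {1..ndof W})"

end

theory Submission
  imports Defs
begin

text \<open>
  The algebraic part is the usual argument for convex limiting. The corrections \<open>\<ell>\<^sub>i\<^sub>j A\<^sub>i\<^sub>j\<close> are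
  antisymmetric, so they cancel in the total mass. For the maximum principle, the limited solution at
  node \<open>i\<close> is the mean, over the neighbours \<open>j\<close>, of the values \<open>f\<^sub>i\<^sup>L + \<ell>\<^sub>i\<^sub>j P\<^sub>i\<^sub>j\<close>, each of which the
  limiter keeps between the local bounds, provided that \<open>f\<^sub>i\<^sup>L\<close> obeys them; without neighbours it is
  \<open>f\<^sub>i\<^sup>L\<close> (\<open>limited_update_bounds\<close>). The low-order update has the form
  \<open>m\<^sub>i (f\<^sub>i\<^sup>L - f\<^sub>i) = \<tau> (\<Sum>j\<noteq>i. (d\<^sub>i\<^sub>j - c\<^sub>i\<^sub>j) (f\<^sub>j - f\<^sub>i))\<close> and is a convex combination under the CFL
  condition (\<open>low_order_bounds\<close>).

  This uses four properties of the discretization: the stencils are symmetric, the lumped masses are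
  positive, and the rows and the columns of the convection matrix sum to zero over the stencils.
  A multilinear function on a cuboid is a combination of its vertex values with nonnegative weights
  (\<open>q1_interpolation\<close>). As the mesh has no hanging nodes, a nodal basis function is therefore
  nonnegative, positive in the interior of the cells that touch its node modulo the periods, and zero
  on the other cells. So its support is the union of the cells that touch its node, two nodes are in
  each other's stencil if and only if they share a cell (\<open>mem_stencil_iff\<close>), and the convection
  matrix vanishes off the stencils (\<open>conv_zero_off_stencil\<close>). Since the basis functions add up to one,
  the row sums vanish, and the column sum at \<open>j\<close> is the integral of \<open>\<beta> \<bullet> \<nabla>\<psi>\<^sub>j\<close>.

  The latter vanishes although \<open>\<beta>\<close> is not periodic in the velocity variable: the component of \<open>\<beta>\<close> in
  each coordinate direction \<open>e\<close> does not depend on that coordinate, and the integral of \<open>g \<partial>\<^sub>e\<psi>\<close> is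
  zero whenever \<open>\<psi>\<close> is periodic and \<open>g\<close> is constant along \<open>e\<close>
  (\<open>integral_derivative_periodic\<close>). Difference quotients prove this without integrating by parts
  cell by cell.
\<close>

section \<open>Multilinear functions on a cuboid\<close>

text \<open>
  The vertices of the cuboid \<open>cbox l u\<close> are indexed by the set of coordinates at their upper end.
\<close>

definition vertex :: "real^'n \<Rightarrow> real^'n \<Rightarrow> 'n set \<Rightarrow> real^'n" where
  "vertex l u S = (\<chi> k. if k \<in> S then u $ k else l $ k)"

text \<open>
  The multilinear Lagrange function of the vertex \<open>vertex l u S\<close>, evaluated at \<open>x\<close>: a product of
  barycentric coordinates, one for each edge direction.
\<close>

definition vertex_weight :: "real^'n \<Rightarrow> real^'n \<Rightarrow> 'n set \<Rightarrow> real^'n \<Rightarrow> real" where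
  "vertex_weight l u S x =
     (\<Prod>k\<in>S. (x $ k - l $ k) / (u $ k - l $ k)) * (\<Prod>k\<in>UNIV - S. (u $ k - x $ k) / (u $ k - l $ k))"

text \<open>
  A multilinear function is the combination of its vertex values with weights that are nonnegative on
  the cuboid and positive in its interior. Sign information at the vertices thus extends to the cuboid.
\<close>

lemma q1_interpolation:
  fixes l u :: "real^'n"
  assumes w: "q1_on (cbox l u) w" and lu: "\<And>k. l $ k < u $ k" and x: "x \<in> cbox l u"
  shows "w x = (\<Sum>S\<in>UNIV. w (vertex l u S) * vertex_weight l u S x)"
proof -
  obtain c where c: "\<And>x. x \<in> cbox l u \<Longrightarrow> w x = (\<Sum>R\<in>UNIV. c R * (\<Prod>k\<in>R. x $ k))"
    using w by (auto simp: q1_on_def)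
  have vert: "vertex l u S \<in> cbox l u" for S
    using lu by (auto simp: mem_box_cart vertex_def less_imp_le)
  have monomial: "(\<Prod>k\<in>R. x $ k) = (\<Sum>S\<in>UNIV. (\<Prod>k\<in>R. vertex l u S $ k) * vertex_weight l u S x)"
    for R :: "'n set"
  proof -
    define t where "t k = (x $ k - l $ k) / (u $ k - l $ k)" for k
    define s where "s k = (u $ k - x $ k) / (u $ k - l $ k)" for k
    define U where "U k = (if k \<in> R then u $ k else 1)" for k
    define L where "L k = (if k \<in> R then l $ k else 1)" for k
    have "(\<Prod>k\<in>R. x $ k) = (\<Prod>k\<in>UNIV. if k \<in> R then x $ k else 1)"
      by (simp add: prod.If_cases)
    \<comment> \<open>Each factor is affine in its coordinate; expanding the product yields the sum over the vertices.\<close>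
    also have "\<dots> = (\<Prod>k\<in>UNIV. U k * t k + L k * s k)"
    proof (rule prod.cong[OF refl])
      fix k
      have "u $ k - l $ k \<noteq> 0" using lu[of k] by simp
      then show "(if k \<in> R then x $ k else 1) = U k * t k + L k * s k"
        by (simp add: U_def L_def t_def s_def flip: add_divide_distrib)
           (simp add: nonzero_eq_divide_eq algebra_simps)
    qed
    also have "\<dots> = (\<Sum>S\<in>UNIV. (\<Prod>k\<in>S. U k * t k) * (\<Prod>k\<in>UNIV - S. L k * s k))"
      by (subst prod_add) auto
    also have "\<dots> = (\<Sum>S\<in>UNIV. (\<Prod>k\<in>R. vertex l u S $ k) * vertex_weight l u S x)"
    proof (rule sum.cong[OF refl])
      fix S
      have "(\<Prod>k\<in>S. U k) * (\<Prod>k\<in>UNIV - S. L k) = (\<Prod>k\<in>UNIV. if k \<in> S then U k else L k)"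
        by (simp add: prod.If_cases Compl_eq_Diff_UNIV)
      also have "\<dots> = (\<Prod>k\<in>UNIV. if k \<in> R then vertex l u S $ k else 1)"
        by (intro prod.cong) (auto simp: U_def L_def vertex_def)
      also have "\<dots> = (\<Prod>k\<in>R. vertex l u S $ k)"
        by (simp add: prod.If_cases)
      finally show "(\<Prod>k\<in>S. U k * t k) * (\<Prod>k\<in>UNIV - S. L k * s k) =
          (\<Prod>k\<in>R. vertex l u S $ k) * vertex_weight l u S x"
        by (simp add: prod.distrib vertex_weight_def flip: t_def s_def)
    qed
    finally show ?thesis .
  qed
  have "w x = (\<Sum>R\<in>UNIV. \<Sum>S\<in>UNIV. c R * (\<Prod>k\<in>R. vertex l u S $ k) * vertex_weight l u S x)"
    unfolding c[OF x] by (subst monomial) (simp add: sum_distrib_left mult.assoc)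
  also have "\<dots> = (\<Sum>S\<in>UNIV. (\<Sum>R\<in>UNIV. c R * (\<Prod>k\<in>R. vertex l u S $ k)) * vertex_weight l u S x)"
    by (subst sum.swap) (simp add: sum_distrib_right)
  finally show ?thesis
    by (simp add: c[OF vert])
qed

lemma vertex_weight_nonneg:
  assumes "\<And>k. l $ k < u $ k" "x \<in> cbox l u"
  shows "0 \<le> vertex_weight l u S x"
  unfolding vertex_weight_def
  using assms by (intro mult_nonneg_nonneg prod_nonneg ballI divide_nonneg_pos) (auto simp: mem_box_cart)

lemma vertex_weight_pos:
  assumes "\<And>k. l $ k < u $ k" "x \<in> box l u"
  shows "0 < vertex_weight l u S x"
  unfolding vertex_weight_def
  using assms by (intro mult_pos_pos prod_pos ballI divide_pos_pos) (auto simp: mem_box_cart)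

lemma vertex_extreme_point:
  assumes lu: "\<And>k. l $ k < u $ k"
  shows "vertex l u S extreme_point_of cbox l u"
  unfolding extreme_point_of_def
proof (intro conjI ballI)
  show "vertex l u S \<in> cbox l u"
    using lu by (auto simp: mem_box_cart vertex_def less_imp_le)
  fix p q assume pq: "p \<in> cbox l u" "q \<in> cbox l u"
  show "vertex l u S \<notin> open_segment p q"
  proof
    assume "vertex l u S \<in> open_segment p q"
    then obtain t where "p \<noteq> q" and t: "0 < t" "t < 1" and eq: "vertex l u S = (1 - t) *\<^sub>R p + t *\<^sub>R q"
      by (auto simp: in_segment)
    have "p $ k = q $ k" for k
    proof -
      have pk: "l $ k \<le> p $ k" "p $ k \<le> u $ k" "l $ k \<le> q $ k" "q $ k \<le> u $ k"
        using pq by (auto simp: mem_box_cart)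
      have e: "(if k \<in> S then u $ k else l $ k) = (1 - t) * p $ k + t * q $ k"
        using arg_cong[OF eq, of "\<lambda>v. v $ k"] by (simp add: vertex_def)
      show ?thesis
      proof (cases "k \<in> S")
        case True
        have "(1 - t) * (u $ k - p $ k) + t * (u $ k - q $ k) = 0"
          using e True by (simp add: algebra_simps)
        moreover have "0 \<le> (1 - t) * (u $ k - p $ k)" "0 \<le> t * (u $ k - q $ k)"
          using pk t by simp_all
        ultimately have "(1 - t) * (u $ k - p $ k) = 0" "t * (u $ k - q $ k) = 0"
          by linarith+
        then show ?thesis using t by simp
      next
        case False
        have "(1 - t) * (p $ k - l $ k) + t * (q $ k - l $ k) = 0"
          using e False by (simp add: algebra_simps)
        moreover have "0 \<le> (1 - t) * (p $ k - l $ k)" "0 \<le> t * (q $ k - l $ k)"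
          using pk t by simp_all
        ultimately have "(1 - t) * (p $ k - l $ k) = 0" "t * (q $ k - l $ k) = 0"
          by linarith+
        then show ?thesis using t by simp
      qed
    qed
    then show False using \<open>p \<noteq> q\<close> by (simp add: vec_eq_iff)
  qed
qed

lemma extreme_point_is_vertex:
  fixes x :: "real^'n"
  assumes x: "x extreme_point_of cbox l u"
  shows "x = vertex l u {k. x $ k = u $ k}"
proof -
  have mem: "l $ k \<le> x $ k" "x $ k \<le> u $ k" for k
    using x by (auto simp: extreme_point_of_def mem_box_cart)
  have "x $ k = l $ k" if "x $ k \<noteq> u $ k" for k
  proof (rule ccontr)
    assume "x $ k \<noteq> l $ k"
    define d where "d = min (x $ k - l $ k) (u $ k - x $ k)"
    have d: "0 < d" "l $ k \<le> x $ k - d" "x $ k + d \<le> u $ k"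
      using mem[of k] that \<open>x $ k \<noteq> l $ k\<close> by (auto simp: d_def)
    define e :: "real^'n" where "e = axis k d"
    have e: "e $ j = (if j = k then d else 0)" for j
      by (simp add: e_def axis_def)
    have mm: "x - e \<in> cbox l u" "x + e \<in> cbox l u"
      using mem d by (auto simp: mem_box_cart e intro: add_increasing2 order_trans[OF mem(1)])
    have "(x - e) $ k \<noteq> (x + e) $ k"
      using d by (simp add: e)
    then have "x - e \<noteq> x + e"
      by metis
    then have "midpoint (x - e) (x + e) \<in> open_segment (x - e) (x + e)"
      by simp
    moreover have "midpoint (x - e) (x + e) = x"
      by (simp add: midpoint_def flip: scaleR_2)
    ultimately have "x \<in> open_segment (x - e) (x + e)"
      by simp
    then show False
      using x mm by (auto simp: extreme_point_of_def)
  qed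
  then show ?thesis
    by (simp add: vec_eq_iff vertex_def)
qed

section \<open>Periodic meshes of cuboids\<close>

lemma mem_periods_iff:
  assumes "\<And>k. a $ k < b $ k"
  shows "p \<in> periods a b \<longleftrightarrow> (\<forall>k. p $ k / (b $ k - a $ k) \<in> \<int>)"
proof
  assume "p \<in> periods a b"
  then obtain z where "p = (\<chi> k. of_int (z k) * (b $ k - a $ k))"
    by (auto simp: periods_def)
  moreover have "b $ k - a $ k \<noteq> 0" for k using assms[of k] by simp
  ultimately show "\<forall>k. p $ k / (b $ k - a $ k) \<in> \<int>"
    by simp
next
  assume "\<forall>k. p $ k / (b $ k - a $ k) \<in> \<int>"
  then have "\<forall>k. \<exists>z. p $ k / (b $ k - a $ k) = of_int z"
    by (auto elim: Ints_cases)
  then obtain z where z: "\<And>k. p $ k / (b $ k - a $ k) = of_int (z k)"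
    by metis
  have "p $ k = of_int (z k) * (b $ k - a $ k)" for k
    using z[of k] assms[of k] by (simp add: field_simps)
  then show "p \<in> periods a b"
    by (auto simp: periods_def vec_eq_iff intro!: exI[of _ z])
qed

locale periodic_mesh =
  fixes a b :: "real^'n" and T :: "(real^'n) set set"
  assumes mesh: "periodic_cuboid_mesh a b T"
begin

lemma box_nondegenerate: "a $ k < b $ k"
  using mesh by (simp add: periodic_cuboid_mesh_def)

lemmas mem_periods = mem_periods_iff[OF box_nondegenerate]

lemma zero_period: "0 \<in> periods a b"
  by (simp add: mem_periods)

lemma period_minus: "p \<in> periods a b \<Longrightarrow> - p \<in> periods a b"
  by (simp add: mem_periods)

lemma coordinate_period: "axis k (b $ k - a $ k) \<in> periods a b"
proof -
  have "axis k (b $ k - a $ k) $ j / (b $ j - a $ j) = (if j = k then 1 else 0)" for j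
    using box_nondegenerate[of k] by (simp add: axis_def)
  then show ?thesis
    by (simp add: mem_periods)
qed

lemma closed_periods: "closed (periods a b)"
proof -
  have "periods a b = (\<Inter>k. (\<lambda>p. p $ k / (b $ k - a $ k)) -` \<int>)"
    by (auto simp: mem_periods)
  also have "closed \<dots>"
    using box_nondegenerate
    by (intro closed_INT ballI continuous_closed_vimage)
       (auto intro!: continuous_intros simp: less_imp_neq[symmetric])
  finally show ?thesis .
qed

lemma reduce_to_fundamental_cell:
  obtains p where "p \<in> periods a b" "\<And>k. a $ k \<le> (y - p) $ k" "\<And>k. (y - p) $ k < b $ k"
proof
  define z where "z k = \<lfloor>(y $ k - a $ k) / (b $ k - a $ k)\<rfloor>" for k
  define p where "p = (\<chi> k. of_int (z k) * (b $ k - a $ k))"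
  show "p \<in> periods a b"
    by (auto simp: periods_def p_def)
  fix k
  have "of_int (z k) \<le> (y $ k - a $ k) / (b $ k - a $ k)" "(y $ k - a $ k) / (b $ k - a $ k) < of_int (z k) + 1"
    unfolding z_def by linarith+
  then have "of_int (z k) * (b $ k - a $ k) \<le> y $ k - a $ k"
    "y $ k - a $ k < (of_int (z k) + 1) * (b $ k - a $ k)"
    using box_nondegenerate[of k] by (simp_all add: pos_le_divide_eq pos_divide_less_eq)
  then show "a $ k \<le> (y - p) $ k" "(y - p) $ k < b $ k"
    by (simp_all add: p_def algebra_simps)
qed

lemma finite_mesh: "finite T"
  using mesh by (auto simp: periodic_cuboid_mesh_def division_of_def)

lemma Union_mesh: "\<Union>T = cbox a b"
  using mesh by (auto simp: periodic_cuboid_mesh_def division_of_def)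

lemma cell_cbox:
  assumes "K \<in> T"
  obtains l u where "K = cbox l u" "\<And>k. l $ k < u $ k"
proof -
  obtain l u where K: "K = cbox l u"
    using mesh assms unfolding periodic_cuboid_mesh_def division_of_def by metis
  moreover have "box l u \<noteq> {}"
    using mesh assms K by (auto simp: periodic_cuboid_mesh_def)
  ultimately show thesis
    using that by (auto simp: interval_ne_empty_cart)
qed

lemma cell_in_mesh: "y \<in> cbox a b \<Longrightarrow> \<exists>K\<in>T. y \<in> K"
  using Union_mesh by blast

text \<open>
  A mesh without hanging nodes, also across the periodic boundary: a vertex of one cell that lies on
  another cell is a vertex of it.
\<close>

lemma extreme_point_of_adjacent_cell:
  assumes K: "K \<in> T" and L: "L \<in> T" and z: "z extreme_point_of K" and p: "p \<in> periods a b" and zp: "z + p \<in> L"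
  shows "(z + p) extreme_point_of L"
proof -
  define K' where "K' = (+) p ` K"
  have z': "(z + p) extreme_point_of K'"
    using z extreme_point_of_translation_eq[of p z K] by (simp add: K'_def add.commute)
  have K'c: "K' \<in> periodic_cells a b T"
    using K p by (auto simp: periodic_cells_def K'_def)
  have Lc: "L \<in> periodic_cells a b T"
    using L zero_period unfolding periodic_cells_def by (auto intro!: exI[of _ 0] exI[of _ L])
  have f1: "(K' \<inter> L) face_of K'" and f2: "(L \<inter> K') face_of L"
    using mesh K'c Lc by (auto simp: periodic_cuboid_mesh_def)
  have "z + p \<in> K'" using z' by (simp add: extreme_point_of_def)
  then have "(z + p) extreme_point_of (K' \<inter> L)"
    using extreme_point_of_face[OF f1] z' zp by simp
  then show ?thesis
    using extreme_point_of_face[OF f2] by (simp add: Int_commute)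
qed

lemma cell_vertex_reduces_to_node:
  assumes K: "K \<in> T" and z: "z extreme_point_of K"
  obtains x p where "x \<in> mesh_nodes a b T" "p \<in> periods a b" "z = x + p"
proof -
  obtain p where p: "p \<in> periods a b" and r: "\<And>k. a $ k \<le> (z - p) $ k" "\<And>k. (z - p) $ k < b $ k"
    by (rule reduce_to_fundamental_cell[of z]) blast
  then have "z - p \<in> cbox a b" by (auto simp: mem_box_cart less_imp_le)
  then obtain L where L: "L \<in> T" "z - p \<in> L" using cell_in_mesh by blast
  have "(z - p) extreme_point_of L"
    using extreme_point_of_adjacent_cell[OF K L(1) z period_minus[OF p]] L by simp
  then have "z - p \<in> mesh_nodes a b T"
    using r L by (auto simp: mesh_nodes_def)
  then show thesis using that p by force
qed

end

section \<open>The nodal basis of the periodic multilinear elements\<close>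

text \<open>
  The space \<open>q1_space a b T\<close> with a nodal basis \<open>X\<close>. Everything needed about the basis functions is
  derived from their values at the nodes and from multilinearity on the cells.
\<close>

locale q1_basis = periodic_mesh +
  fixes X :: "(real^'n) fe_space"
  assumes nodal: "q1_nodal a b T X"
begin

abbreviation "dofs \<equiv> {1..ndof X}"

lemma dom_eq: "fe_dom X = cbox a b"
  using nodal by (simp add: q1_nodal_def)

lemma node_in_mesh_nodes: "i \<in> dofs \<Longrightarrow> node X i \<in> mesh_nodes a b T"
  using nodal by (auto simp: q1_nodal_def bij_betw_def)

lemma mesh_node_is_node: "x \<in> mesh_nodes a b T \<Longrightarrow> \<exists>j\<in>dofs. x = node X j"
  using nodal by (auto simp: q1_nodal_def bij_betw_def)

lemma shape_node: "i \<in> dofs \<Longrightarrow> j \<in> dofs \<Longrightarrow> shape X i (node X j) = (if i = j then 1 else 0)"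
  using nodal by (simp add: q1_nodal_def)

lemma shape_in_q1_space: "i \<in> dofs \<Longrightarrow> shape X i \<in> q1_space a b T"
  using nodal by (simp add: q1_nodal_def)

lemma shape_continuous: "i \<in> dofs \<Longrightarrow> continuous_on UNIV (shape X i)"
  using shape_in_q1_space by (simp add: q1_space_def)

lemma shape_periodic: "i \<in> dofs \<Longrightarrow> p \<in> periods a b \<Longrightarrow> shape X i (y + p) = shape X i y"
  using shape_in_q1_space by (simp add: q1_space_def)

lemma shape_q1_on: "i \<in> dofs \<Longrightarrow> K \<in> T \<Longrightarrow> q1_on K (shape X i)"
  using shape_in_q1_space by (simp add: q1_space_def)

lemma node_in_dom: "i \<in> dofs \<Longrightarrow> node X i \<in> cbox a b"
  using node_in_mesh_nodes by (fastforce simp: mesh_nodes_def mem_box_cart less_imp_le)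

lemma partition_of_unity: "(\<Sum>i\<in>dofs. shape X i y) = 1"
proof -
  have "q1_on K (\<lambda>y. 1)" for K :: "(real^'n) set"
    unfolding q1_on_def
  proof (intro exI ballI)
    fix x :: "real^'n"
    have "(\<Sum>S\<in>UNIV. (if S = {} then 1 else 0) * (\<Prod>k\<in>S. x $ k)) =
        (\<Sum>S\<in>(UNIV :: 'n set set). if S = {} then 1 else (0::real))"
      by (rule sum.cong) simp_all
    then show "1 = (\<Sum>S\<in>UNIV. (if S = {} then 1 else 0) * (\<Prod>k\<in>S. x $ k))"
      by simp
  qed
  then have "(\<lambda>y. 1) \<in> q1_space a b T"
    by (simp add: q1_space_def)
  then obtain c where c: "(\<lambda>y. 1) = fe_fun X c"
    using nodal by (auto simp: q1_nodal_def)
  have "c j = 1" if j: "j \<in> dofs" for j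
  proof -
    have "1 = (\<Sum>i\<in>dofs. c i * shape X i (node X j))"
      using fun_cong[OF c, of "node X j"] by (simp add: fe_fun_def)
    also have "\<dots> = (\<Sum>i\<in>dofs. if i = j then c i else 0)"
      using j by (intro sum.cong) (auto simp: shape_node)
    also have "\<dots> = c j" using j by simp
    finally show ?thesis by simp
  qed
  then show ?thesis
    using fun_cong[OF c, of y] by (simp add: fe_fun_def)
qed

text \<open>Some periodic translate of node \<open>i\<close> lies on the cell \<open>K\<close>.\<close>

definition touches :: "nat \<Rightarrow> (real^'n) set \<Rightarrow> bool" where
  "touches i K \<longleftrightarrow> (\<exists>p\<in>periods a b. node X i + p \<in> K)"

lemma shape_at_cell_vertex:
  assumes i: "i \<in> dofs" and K: "K \<in> T" and z: "z extreme_point_of K"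
  shows "shape X i z = 0 \<or> shape X i z = 1 \<and> touches i K"
proof -
  obtain x p where x: "x \<in> mesh_nodes a b T" and p: "p \<in> periods a b" and zx: "z = x + p"
    by (rule cell_vertex_reduces_to_node[OF K z])
  then obtain j where j: "j \<in> dofs" "x = node X j" using mesh_node_is_node by blast
  have "shape X i z = (if i = j then 1 else 0)"
    using shape_periodic[OF i p] shape_node[OF i j(1)] j zx by simp
  moreover have "z \<in> K" using z by (simp add: extreme_point_of_def)
  ultimately show ?thesis
    using p j zx by (auto simp: touches_def)
qed

lemma shape_nonneg_cell:
  assumes i: "i \<in> dofs" and K: "K \<in> T" and y: "y \<in> K"
  shows "0 \<le> shape X i y"
proof -
  obtain l u where lu: "K = cbox l u" "\<And>k. l $ k < u $ k" using K by (rule cell_cbox) blast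
  have "0 \<le> shape X i (vertex l u S)" for S
    using shape_at_cell_vertex[OF i K, of "vertex l u S"] vertex_extreme_point[OF lu(2), of S]
    by (auto simp: lu(1))
  then show ?thesis
    using q1_interpolation[OF _ lu(2), of "shape X i" y] shape_q1_on[OF i K] y vertex_weight_nonneg[OF lu(2)] lu(1)
    by (auto intro!: sum_nonneg)
qed

lemma shape_zero_off_touched_cells:
  assumes i: "i \<in> dofs" and K: "K \<in> T" and y: "y \<in> K" and n: "\<not> touches i K"
  shows "shape X i y = 0"
proof -
  obtain l u where lu: "K = cbox l u" "\<And>k. l $ k < u $ k" using K by (rule cell_cbox) blast
  have "shape X i (vertex l u S) = 0" for S
    using shape_at_cell_vertex[OF i K, of "vertex l u S"] vertex_extreme_point[OF lu(2), of S] n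
    by (auto simp: lu(1))
  then show ?thesis
    using q1_interpolation[OF _ lu(2), of "shape X i" y] shape_q1_on[OF i K] y lu(1) by auto
qed

text \<open>
  On a cell touched by node \<open>i\<close> the shape function has a vertex value \<open>1\<close>, the others are \<open>0\<close> or
  \<open>1\<close>, and all weights are positive in the interior.
\<close>

lemma shape_pos_on_touched_cells:
  assumes i: "i \<in> dofs" and K: "K \<in> T" and y: "y \<in> interior K" and t: "touches i K"
  shows "0 < shape X i y"
proof -
  obtain l u where lu: "K = cbox l u" "\<And>k. l $ k < u $ k" using K by (rule cell_cbox) blast
  have yb: "y \<in> box l u" "y \<in> cbox l u" using y lu(1) box_subset_cbox[of l u] by auto
  obtain p where p: "p \<in> periods a b" "node X i + p \<in> K" using t by (auto simp: touches_def)
  obtain K0 where K0: "K0 \<in> T" "node X i extreme_point_of K0"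
    using node_in_mesh_nodes[OF i] by (auto simp: mesh_nodes_def)
  have "(node X i + p) extreme_point_of cbox l u"
    using extreme_point_of_adjacent_cell[OF K0(1) K K0(2) p] lu by simp
  then obtain R where R: "node X i + p = vertex l u R"
    using extreme_point_is_vertex by blast
  have one: "shape X i (vertex l u R) = 1"
    using shape_periodic[OF i p(1), of "node X i"] shape_node[OF i i] by (simp add: R)
  have "0 \<le> shape X i (vertex l u S)" for S
    using shape_at_cell_vertex[OF i K, of "vertex l u S"] vertex_extreme_point[OF lu(2), of S]
    by (auto simp: lu(1))
  then have "0 \<le> shape X i (vertex l u S) * vertex_weight l u S y" for S
    using vertex_weight_nonneg[OF lu(2) yb(2)] by simp
  moreover have "0 < shape X i (vertex l u R) * vertex_weight l u R y"
    using one vertex_weight_pos[OF lu(2) yb(1)] by simp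
  ultimately have "0 < (\<Sum>S\<in>UNIV. shape X i (vertex l u S) * vertex_weight l u S y)"
    by (intro sum_pos2[of _ R]) auto
  then show ?thesis
    using q1_interpolation[OF _ lu(2), of "shape X i" y] shape_q1_on[OF i K] yb lu(1) by auto
qed

lemma shape_nonneg:
  assumes i: "i \<in> dofs"
  shows "0 \<le> shape X i y"
proof -
  obtain p where p: "p \<in> periods a b" "\<And>k. a $ k \<le> (y - p) $ k" "\<And>k. (y - p) $ k < b $ k"
    by (rule reduce_to_fundamental_cell[of y]) blast
  then have "y - p \<in> cbox a b" by (auto simp: mem_box_cart less_imp_le)
  then have "0 \<le> shape X i (y - p)" using shape_nonneg_cell[OF i] cell_in_mesh by blast
  then show ?thesis using shape_periodic[OF i p(1), of "y - p"] by simp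
qed

text \<open>
  Hence the support of a shape function on the torus is the union of the cells touched by its node.
  The right-hand side is symmetric in \<open>i\<close> and \<open>j\<close>; this gives the symmetry of the stencils.
\<close>

lemma node_in_support_iff:
  assumes i: "i \<in> dofs"
  shows "node X j \<in> closure {y. shape X i y \<noteq> 0} \<longleftrightarrow> (\<exists>K\<in>T. touches i K \<and> touches j K)"
    (is "_ \<in> closure ?S \<longleftrightarrow> _")
proof
  define F where "F = (\<Union>K\<in>{K \<in> T. touches i K}. \<Union>x\<in>K. \<Union>p\<in>periods a b. {x + p})"
  \<comment> \<open>\<open>F\<close> is the periodic extension of the touched cells, a sum of compact sets and the closed set of periods.\<close>
  have "closed F"
    unfolding F_def
  proof (rule closed_UN)
    show "finite {K \<in> T. touches i K}" using finite_mesh by simp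
    show "\<forall>K\<in>{K \<in> T. touches i K}. closed (\<Union>x\<in>K. \<Union>p\<in>periods a b. {x + p})"
      using closed_periods by (auto intro!: compact_closed_sums elim: cell_cbox)
  qed
  moreover have "?S \<subseteq> F"
  proof
    fix y assume y: "y \<in> ?S"
    obtain p where p: "p \<in> periods a b" "\<And>k. a $ k \<le> (y - p) $ k" "\<And>k. (y - p) $ k < b $ k"
      by (rule reduce_to_fundamental_cell[of y]) blast
    then have "y - p \<in> cbox a b" by (auto simp: mem_box_cart less_imp_le)
    then obtain K where K: "K \<in> T" "y - p \<in> K" using cell_in_mesh by blast
    have "shape X i (y - p) \<noteq> 0" using shape_periodic[OF i p(1), of "y - p"] y by simp
    then have "touches i K" using shape_zero_off_touched_cells[OF i K] by blast
    moreover have "y = (y - p) + p" by simp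
    ultimately show "y \<in> F" unfolding F_def using K p(1) by blast
  qed
  ultimately have "closure ?S \<subseteq> F" by (simp add: closure_minimal)
  moreover assume "node X j \<in> closure ?S"
  ultimately obtain K x p where K: "K \<in> T" "touches i K" "x \<in> K" "p \<in> periods a b" "node X j = x + p"
    by (auto simp: F_def)
  then have "touches j K"
    using period_minus[OF K(4)] by (auto simp: touches_def intro!: bexI[of _ "- p"])
  with K show "\<exists>K\<in>T. touches i K \<and> touches j K" by blast
next
  assume "\<exists>K\<in>T. touches i K \<and> touches j K"
  then obtain K q where K: "K \<in> T" "touches i K" and q: "q \<in> periods a b" "node X j + q \<in> K"
    by (auto simp: touches_def)
  obtain l u where lu: "K = cbox l u" "\<And>k. l $ k < u $ k" using K(1) by (rule cell_cbox) blast
  then have "box l u \<noteq> {}" by (simp add: interval_ne_empty_cart)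
  then have "K = closure (interior K)"
    using lu by (simp add: closure_box)
  also have "\<dots> \<subseteq> closure ?S"
    using shape_pos_on_touched_cells[OF i K(1) _ K(2)] by (intro closure_mono) force
  finally have "node X j + q \<in> closure ?S" using q by blast
  then have "node X j \<in> (+) (- q) ` closure ?S"
    by (intro image_eqI[of _ _ "node X j + q"]) simp_all
  also have "\<dots> = closure ((+) (- q) ` ?S)" by (rule closure_translation[symmetric])
  also have "\<dots> \<subseteq> closure ?S"
  proof (rule closure_mono)
    show "(+) (- q) ` ?S \<subseteq> ?S"
      using shape_periodic[OF i period_minus[OF q(1)]] by (auto simp: add.commute)
  qed
  finally show "node X j \<in> closure ?S" .
qed

end

section \<open>Piecewise polynomial functions on a box\<close>

lemma real_polynomial_function_has_derivative:
  fixes P :: "'a::euclidean_space \<Rightarrow> real"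
  assumes "real_polynomial_function P"
  obtains P' where "\<And>y. (P has_derivative P' y) (at y)" "\<And>e. real_polynomial_function (\<lambda>y. P' y e)"
proof -
  have "\<exists>P'. (\<forall>y. (P has_derivative P' y) (at y)) \<and> (\<forall>e. real_polynomial_function (\<lambda>y. P' y e))"
    using assms
  proof induction
    case (linear f)
    then show ?case
      by (intro exI[of _ "\<lambda>y. f"]) (auto intro: bounded_linear_imp_has_derivative)
  next
    case (const c)
    then show ?case
      by (intro exI[of _ "\<lambda>y e. 0"]) auto
  next
    case (add f g)
    then obtain f' g' where "\<And>y. (f has_derivative f' y) (at y)" "\<And>e. real_polynomial_function (\<lambda>y. f' y e)"
      "\<And>y. (g has_derivative g' y) (at y)" "\<And>e. real_polynomial_function (\<lambda>y. g' y e)"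
      by blast
    then show ?case
      by (intro exI[of _ "\<lambda>y e. f' y e + g' y e"]) (auto intro: has_derivative_add)
  next
    case (mult f g)
    then obtain f' g' where "\<And>y. (f has_derivative f' y) (at y)" "\<And>e. real_polynomial_function (\<lambda>y. f' y e)"
      "\<And>y. (g has_derivative g' y) (at y)" "\<And>e. real_polynomial_function (\<lambda>y. g' y e)"
      by blast
    then show ?case
      using mult.hyps
      by (intro exI[of _ "\<lambda>y e. f y * g' y e + f' y e * g y"] conjI allI has_derivative_mult
            real_polynomial_function.intros(3,4))
  qed
  then show thesis using that by blast
qed

lemma real_polynomial_function_lipschitz_on_compact:
  fixes P :: "'a::euclidean_space \<Rightarrow> real"
  assumes "real_polynomial_function P" and K: "compact K"
  shows "\<exists>L. L-lipschitz_on K P"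
  using assms(1)
proof induction
  case (linear f)
  then obtain B where "\<And>x. norm (f x) \<le> norm x * B" "B \<ge> 0"
    using bounded_linear.nonneg_bounded by blast
  then have "B-lipschitz_on K f"
    by (intro lipschitz_onI) (simp_all add: dist_norm mult.commute flip: linear_diff[OF bounded_linear.linear[OF linear]])
  then show ?case by blast
next
  case (const c)
  show ?case using lipschitz_on_constant by blast
next
  case (add f g)
  then show ?case using lipschitz_on_add by blast
next
  case (mult f g)
  then obtain L M where L: "L-lipschitz_on K f" and M: "M-lipschitz_on K g" by blast
  have "bounded (f ` K)" "bounded (g ` K)"
    using K L M by (auto intro!: compact_imp_bounded compact_continuous_image lipschitz_on_continuous_on)
  then obtain A B where A: "\<And>x. x \<in> K \<Longrightarrow> \<bar>f x\<bar> \<le> A" and B: "\<And>x. x \<in> K \<Longrightarrow> \<bar>g x\<bar> \<le> B"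
    by (auto simp: bounded_iff)
  have "(\<bar>A\<bar> * M + \<bar>B\<bar> * L)-lipschitz_on K (\<lambda>x. f x * g x)"
  proof (rule lipschitz_onI)
    fix x y assume xy: "x \<in> K" "y \<in> K"
    have d: "\<bar>f x - f y\<bar> \<le> L * dist x y" "\<bar>g x - g y\<bar> \<le> M * dist x y"
      using lipschitz_onD[OF L xy] lipschitz_onD[OF M xy] by (simp_all add: dist_real_def)
    have "f x * g x - f y * g y = f x * (g x - g y) + g y * (f x - f y)"
      by (simp add: algebra_simps)
    then have "\<bar>f x * g x - f y * g y\<bar> \<le> \<bar>f x\<bar> * \<bar>g x - g y\<bar> + \<bar>g y\<bar> * \<bar>f x - f y\<bar>"
      by (metis abs_mult abs_triangle_ineq)
    also have "\<dots> \<le> \<bar>A\<bar> * (M * dist x y) + \<bar>B\<bar> * (L * dist x y)"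
      using A[OF xy(1)] B[OF xy(2)] d by (intro add_mono mult_mono) auto
    finally show "dist (f x * g x) (f y * g y) \<le> (\<bar>A\<bar> * M + \<bar>B\<bar> * L) * dist x y"
      by (simp add: dist_real_def algebra_simps)
  qed (use lipschitz_on_nonneg[OF L] lipschitz_on_nonneg[OF M] in simp)
  then show ?case by blast
qed

text \<open>
  Functions that are polynomial in the interior of each cell. The values on the cell faces are left
  open, since gradients of finite element functions and the given fields are arbitrary there.
\<close>

definition piecewise_poly :: "'a::euclidean_space set set \<Rightarrow> ('a \<Rightarrow> real) \<Rightarrow> bool" where
  "piecewise_poly C F \<longleftrightarrow> (\<forall>K\<in>C. \<exists>G. real_polynomial_function G \<and> (\<forall>y\<in>interior K. F y = G y))"

lemma piecewise_poly_const: "piecewise_poly C (\<lambda>y. c)"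
  by (auto simp: piecewise_poly_def)

lemma piecewise_poly_add:
  assumes "piecewise_poly C F" "piecewise_poly C G"
  shows "piecewise_poly C (\<lambda>y. F y + G y)"
  unfolding piecewise_poly_def
proof
  fix K assume K: "K \<in> C"
  obtain f where "real_polynomial_function f" "\<forall>y\<in>interior K. F y = f y"
    using assms(1) K by (auto simp: piecewise_poly_def)
  moreover obtain g where "real_polynomial_function g" "\<forall>y\<in>interior K. G y = g y"
    using assms(2) K by (auto simp: piecewise_poly_def)
  ultimately show "\<exists>h. real_polynomial_function h \<and> (\<forall>y\<in>interior K. F y + G y = h y)"
    by (intro exI[of _ "\<lambda>y. f y + g y"]) auto
qed

lemma piecewise_poly_mult:
  assumes "piecewise_poly C F" "piecewise_poly C G"
  shows "piecewise_poly C (\<lambda>y. F y * G y)"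
  unfolding piecewise_poly_def
proof
  fix K assume K: "K \<in> C"
  obtain f where "real_polynomial_function f" "\<forall>y\<in>interior K. F y = f y"
    using assms(1) K by (auto simp: piecewise_poly_def)
  moreover obtain g where "real_polynomial_function g" "\<forall>y\<in>interior K. G y = g y"
    using assms(2) K by (auto simp: piecewise_poly_def)
  ultimately show "\<exists>h. real_polynomial_function h \<and> (\<forall>y\<in>interior K. F y * G y = h y)"
    by (intro exI[of _ "\<lambda>y. f y * g y"]) auto
qed

lemma piecewise_poly_diff:
  assumes "piecewise_poly C F" "piecewise_poly C G"
  shows "piecewise_poly C (\<lambda>y. F y - G y)"
  using piecewise_poly_add[OF assms(1) piecewise_poly_mult[OF piecewise_poly_const[of C "-1"] assms(2)]]
  by simp

lemma piecewise_poly_sum: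
  "(\<And>i. i \<in> I \<Longrightarrow> piecewise_poly C (F i)) \<Longrightarrow> piecewise_poly C (\<lambda>y. \<Sum>i\<in>I. F i y)"
  by (induction I rule: infinite_finite_induct) (auto intro: piecewise_poly_const piecewise_poly_add)

lemma piecewise_poly_has_derivative:
  assumes "piecewise_poly C F" "K \<in> C" "y \<in> interior K"
  shows "(F has_derivative frechet_derivative F (at y)) (at y)"
proof -
  obtain G where G: "real_polynomial_function G" "\<forall>y\<in>interior K. F y = G y"
    using assms by (auto simp: piecewise_poly_def)
  obtain G' where "(G has_derivative G' y) (at y)"
    using real_polynomial_function_has_derivative[OF G(1)] by metis
  then have "(F has_derivative G' y) (at y)"
    using G assms(3) by (auto intro: has_derivative_transform_within_open[of G _ y UNIV "interior K"])
  then show ?thesis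
    by (meson differentiableI frechet_derivative_works)
qed

lemma piecewise_poly_frechet_derivative:
  assumes "piecewise_poly C F"
  shows "piecewise_poly C (\<lambda>y. frechet_derivative F (at y) e)"
  unfolding piecewise_poly_def
proof
  fix K assume K: "K \<in> C"
  then obtain G where G: "real_polynomial_function G" "\<forall>y\<in>interior K. F y = G y"
    using assms by (auto simp: piecewise_poly_def)
  obtain G' where G': "\<And>y. (G has_derivative G' y) (at y)" "\<And>e. real_polynomial_function (\<lambda>y. G' y e)"
    using real_polynomial_function_has_derivative[OF G(1)] by metis
  have "frechet_derivative F (at y) = G' y" if "y \<in> interior K" for y
  proof -
    have "(F has_derivative G' y) (at y)"
      using G(2) G'(1) that by (auto intro: has_derivative_transform_within_open[of G _ y UNIV "interior K"])
    then show ?thesis by (rule frechet_derivative_at[symmetric])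
  qed
  then show "\<exists>h. real_polynomial_function h \<and> (\<forall>y\<in>interior K. frechet_derivative F (at y) e = h y)"
    using G'(2) by (intro exI[of _ "\<lambda>y. G' y e"]) auto
qed

section \<open>Integrals over a box covered by cells\<close>

text \<open>
  Shifting a function that is periodic in the direction \<open>e\<close> along \<open>e\<close> does not change its integral
  over a period box: the part of the shifted box that leaves the box re-enters on the opposite side.
\<close>

lemma has_integral_periodic_shift:
  fixes G :: "'a::euclidean_space \<Rightarrow> real"
  assumes e: "e \<in> Basis" and c: "c = (b - a) \<bullet> e" and s: "0 \<le> s" "s \<le> c"
    and per: "\<And>y. G (y + c *\<^sub>R e) = G y" and int: "G integrable_on cbox a b"
  shows "((\<lambda>y. G (y + s *\<^sub>R e)) has_integral integral (cbox a b) G) (cbox a b)"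
proof -
  define \<alpha> where "\<alpha> = a \<bullet> e + s"
  define u where "u = (\<Sum>i\<in>Basis. (if i = e then min (b \<bullet> e) \<alpha> else b \<bullet> i) *\<^sub>R i)"
  have low: "cbox a b \<inter> {x. x \<bullet> e \<le> \<alpha>} = cbox a u"
    unfolding u_def by (rule interval_split(1)[OF e])
  obtain I where I: "(G has_integral I) (cbox a b \<inter> {x. x \<bullet> e \<le> \<alpha>})"
    using integrable_split(1)[OF int e] by (auto simp: integrable_on_def)
  obtain J where J: "(G has_integral J) (cbox a b \<inter> {x. x \<bullet> e \<ge> \<alpha>})"
    using integrable_split(2)[OF int e] by (auto simp: integrable_on_def)
  have IJ: "integral (cbox a b) G = J + I"
    using has_integral_split[OF I J e] by (simp add: integral_unique add.commute)
  have "(G has_integral I) (cbox (a + c *\<^sub>R e) (u + c *\<^sub>R e))"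
    using I has_integral_shift_cbox_iff[of G "c *\<^sub>R e" I a u] per low
    by (simp add: o_def add.commute)
  moreover have "cbox (a + c *\<^sub>R e) (u + c *\<^sub>R e) = cbox (a + s *\<^sub>R e) (b + s *\<^sub>R e) \<inter> {x. x \<bullet> e \<ge> b \<bullet> e}"
  proof (rule set_eqI)
    fix x
    have ue: "u \<bullet> i = (if i = e then min (b \<bullet> e) \<alpha> else b \<bullet> i)" if "i \<in> Basis" for i
      using that by (simp add: u_def)
    have split: "(\<forall>i\<in>Basis. P i) \<longleftrightarrow> P e \<and> (\<forall>i\<in>Basis - {e}. P i)" for P
      using e by auto
    have "x \<in> cbox (a + c *\<^sub>R e) (u + c *\<^sub>R e) \<longleftrightarrow>
        (b \<bullet> e \<le> x \<bullet> e \<and> x \<bullet> e \<le> min (b \<bullet> e) \<alpha> + c) \<and> (\<forall>i\<in>Basis - {e}. a \<bullet> i \<le> x \<bullet> i \<and> x \<bullet> i \<le> b \<bullet> i)"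
      unfolding mem_box split using e c by (auto simp: inner_add_left inner_diff_left ue inner_Basis)
    moreover have "x \<in> cbox (a + s *\<^sub>R e) (b + s *\<^sub>R e) \<longleftrightarrow>
        (a \<bullet> e + s \<le> x \<bullet> e \<and> x \<bullet> e \<le> b \<bullet> e + s) \<and> (\<forall>i\<in>Basis - {e}. a \<bullet> i \<le> x \<bullet> i \<and> x \<bullet> i \<le> b \<bullet> i)"
      unfolding mem_box split using e by (auto simp: inner_add_left inner_Basis)
    moreover have "\<alpha> \<le> b \<bullet> e" "\<alpha> + c = b \<bullet> e + s"
      using s c by (simp_all add: \<alpha>_def inner_diff_left)
    ultimately show "x \<in> cbox (a + c *\<^sub>R e) (u + c *\<^sub>R e) \<longleftrightarrow>
        x \<in> cbox (a + s *\<^sub>R e) (b + s *\<^sub>R e) \<inter> {x. x \<bullet> e \<ge> b \<bullet> e}"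
      using \<alpha>_def by auto
  qed
  moreover have "cbox a b \<inter> {x. x \<bullet> e \<ge> \<alpha>} = cbox (a + s *\<^sub>R e) (b + s *\<^sub>R e) \<inter> {x. x \<bullet> e \<le> b \<bullet> e}"
  proof (rule set_eqI)
    fix x
    have split: "(\<forall>i\<in>Basis. P i) \<longleftrightarrow> P e \<and> (\<forall>i\<in>Basis - {e}. P i)" for P
      using e by auto
    have "x \<in> cbox a b \<longleftrightarrow>
        (a \<bullet> e \<le> x \<bullet> e \<and> x \<bullet> e \<le> b \<bullet> e) \<and> (\<forall>i\<in>Basis - {e}. a \<bullet> i \<le> x \<bullet> i \<and> x \<bullet> i \<le> b \<bullet> i)"
      unfolding mem_box split using e by simp
    moreover have "x \<in> cbox (a + s *\<^sub>R e) (b + s *\<^sub>R e) \<longleftrightarrow>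
        (a \<bullet> e + s \<le> x \<bullet> e \<and> x \<bullet> e \<le> b \<bullet> e + s) \<and> (\<forall>i\<in>Basis - {e}. a \<bullet> i \<le> x \<bullet> i \<and> x \<bullet> i \<le> b \<bullet> i)"
      unfolding mem_box split using e by (auto simp: inner_add_left inner_Basis)
    ultimately show "x \<in> cbox a b \<inter> {x. x \<bullet> e \<ge> \<alpha>} \<longleftrightarrow>
        x \<in> cbox (a + s *\<^sub>R e) (b + s *\<^sub>R e) \<inter> {x. x \<bullet> e \<le> b \<bullet> e}"
      using \<alpha>_def s by auto
  qed
  ultimately have "(G has_integral J + I) (cbox (a + s *\<^sub>R e) (b + s *\<^sub>R e))"
    using J by (intro has_integral_split[OF _ _ e, of _ _ _ _ "b \<bullet> e"]) auto
  then show ?thesis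
    using has_integral_shift_cbox_iff[of G "s *\<^sub>R e" "J + I" a b] by (simp add: o_def add.commute IJ)
qed

text \<open>
  A box as a finite union of boxes. They may overlap, since integrals are never split along the cells.
\<close>

locale box_cover =
  fixes a b :: "'a::euclidean_space" and C :: "'a set set"
  assumes finite_cells: "finite C" and Union_cells: "\<Union>C = cbox a b"
    and cells_cbox: "K \<in> C \<Longrightarrow> \<exists>l u. K = cbox l u"
begin

lemma negligible_cell_faces: "negligible (\<Union>K\<in>C. frontier K)"
proof (intro negligible_Union ballI)
  show "finite (frontier ` C)" using finite_cells by simp
  show "negligible F" if "F \<in> frontier ` C" for F
    using that cells_cbox by (fastforce intro: negligible_convex_frontier)
qed

lemma interior_of_cell:
  assumes "y \<in> cbox a b - (\<Union>K\<in>C. frontier K)"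
  obtains K where "K \<in> C" "y \<in> interior K"
proof -
  obtain K where K: "K \<in> C" "y \<in> K" using assms Union_cells by blast
  then have "closed K" using cells_cbox by (metis closed_cbox)
  then show thesis using that K assms by (auto simp: frontier_def)
qed

lemma piecewise_poly_integrable:
  assumes "piecewise_poly C F"
  shows "F absolutely_integrable_on cbox a b"
proof -
  have "set_integrable lebesgue (\<Union>K\<in>C. K) F"
  proof (rule set_integrable_UN[OF finite_cells])
    fix K assume K: "K \<in> C"
    then obtain l u where lu: "K = cbox l u" using cells_cbox by blast
    then show "K \<in> sets lebesgue" by simp
    obtain G where G: "real_polynomial_function G" "\<forall>y\<in>interior K. F y = G y"
      using assms K by (auto simp: piecewise_poly_def)
    have "G absolutely_integrable_on cbox l u"
      using G by (intro absolutely_integrable_continuous continuous_on_polymonial_function)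
                 (simp add: real_polynomial_function_eq)
    then have "F absolutely_integrable_on cbox l u"
    proof (rule absolutely_integrable_spike)
      show "negligible (frontier K)"
        using lu by (auto intro: negligible_convex_frontier)
      show "F x = G x" if "x \<in> cbox l u - frontier K" for x
        using that lu G by (auto simp: frontier_def)
    qed
    then show "set_integrable lebesgue K F" using lu by simp
  qed
  then show ?thesis using Union_cells by simp
qed

text \<open>
  A periodic piecewise polynomial function that is polynomial on the closed cells is Lipschitz along
  \<open>e\<close> over one period, uniformly in the starting point: a segment that starts in the box is covered by
  finitely many cells and their translates by one period.
\<close>

lemma lipschitz_in_direction:
  assumes e: "e \<in> Basis" and c: "c = (b - a) \<bullet> e"
    and per: "\<And>y. w (y + c *\<^sub>R e) = w y"
    and poly: "\<And>K. K \<in> C \<Longrightarrow> \<exists>G. real_polynomial_function G \<and> (\<forall>y\<in>K. w y = G y)"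
  obtains M where "0 \<le> M" "\<And>y s. y \<in> cbox a b \<Longrightarrow> 0 \<le> s \<Longrightarrow> s \<le> c \<Longrightarrow> \<bar>w (y + s *\<^sub>R e) - w y\<bar> \<le> M * s"
proof -
  have "\<exists>L. L-lipschitz_on K w" if K: "K \<in> C" for K
  proof -
    obtain G where G: "real_polynomial_function G" "\<forall>y\<in>K. w y = G y" using poly[OF K] by blast
    moreover have "compact K" using cells_cbox[OF K] by auto
    ultimately obtain L where "L-lipschitz_on K G"
      using real_polynomial_function_lipschitz_on_compact by blast
    then have "L-lipschitz_on K w" using G(2) by (simp add: lipschitz_on_def)
    then show ?thesis by blast
  qed
  then obtain L where L: "\<And>K. K \<in> C \<Longrightarrow> (L K)-lipschitz_on K w" by metis
  define M where "M = (\<Sum>K\<in>C. L K)"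
  have L0: "0 \<le> L K" if "K \<in> C" for K using lipschitz_on_nonneg[OF L[OF that]] .
  have M0: "0 \<le> M" unfolding M_def using L0 by (rule sum_nonneg)
  have M: "M-lipschitz_on K w" if "K \<in> C" for K
    using L[OF that] member_le_sum[OF that, of L] L0 finite_cells
    by (intro lipschitz_on_mono[OF L[OF that] order_refl]) (auto simp: M_def)
  have "\<bar>w (y + s *\<^sub>R e) - w y\<bar> \<le> M * s" if y: "y \<in> cbox a b" and s: "0 \<le> s" "s \<le> c" for y s
  proof -
    define U where "U = (\<lambda>(K, m). {t. y + (t - m) *\<^sub>R e \<in> K})"
    have "M-lipschitz_on {0..s} (\<lambda>t. w (y + t *\<^sub>R e))"
    proof (rule lipschitz_on_closed_Union[where I = "C \<times> {0, c}" and U = U])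
      show "finite (C \<times> {0, c})" using finite_cells by simp
      show "0 \<le> M" by (rule M0)
    next
      fix i assume "i \<in> C \<times> {0, c}"
      then obtain K m where i: "i = (K, m)" and K: "K \<in> C" and m: "m = 0 \<or> m = c" by auto
      have wm: "w (y + t *\<^sub>R e) = w (y + (t - m) *\<^sub>R e)" for t
        using m per[of "y + (t - c) *\<^sub>R e"] by (auto simp: algebra_simps)
      show "M-lipschitz_on (U i) (\<lambda>t. w (y + t *\<^sub>R e))"
      proof (rule lipschitz_onI[OF _ M0])
        fix t r assume "t \<in> U i" "r \<in> U i"
        then have "dist (w (y + (t - m) *\<^sub>R e)) (w (y + (r - m) *\<^sub>R e)) \<le>
            M * dist (y + (t - m) *\<^sub>R e) (y + (r - m) *\<^sub>R e)"
          using lipschitz_onD[OF M[OF K], of "y + (t - m) *\<^sub>R e" "y + (r - m) *\<^sub>R e"] by (simp add: U_def i)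
        also have "dist (y + (t - m) *\<^sub>R e) (y + (r - m) *\<^sub>R e) = dist t r"
          using e by (simp add: dist_norm real_norm_def flip: scaleR_diff_left)
        finally show "dist (w (y + t *\<^sub>R e)) (w (y + r *\<^sub>R e)) \<le> M * dist t r"
          by (simp only: wm[of t] wm[of r])
      qed
      have "closed K" using cells_cbox[OF K] by auto
      then have "closed ((\<lambda>t. y + (t - m) *\<^sub>R e) -` K)"
        by (intro continuous_closed_vimage) (auto intro!: continuous_intros)
      then show "closed (U i)" by (simp add: U_def i vimage_def)
    next
      show "{0..s} \<subseteq> (\<Union>i\<in>C \<times> {0, c}. U i)"
      proof
        fix t assume t: "t \<in> {0..s}"
        have ye: "a \<bullet> i \<le> y \<bullet> i \<and> y \<bullet> i \<le> b \<bullet> i" if "i \<in> Basis" for i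
          using y that by (simp add: mem_box)
        have "y + (t - 0) *\<^sub>R e \<in> cbox a b \<or> y + (t - c) *\<^sub>R e \<in> cbox a b"
        proof (cases "y \<bullet> e + t \<le> b \<bullet> e")
          case True
          then have "y + (t - 0) *\<^sub>R e \<in> cbox a b"
            using ye t e by (auto simp: mem_box inner_add_left inner_Basis intro: add_increasing2)
          then show ?thesis ..
        next
          case False
          then have "a \<bullet> e \<le> y \<bullet> e + (t - c)" "y \<bullet> e + (t - c) \<le> b \<bullet> e"
            using ye[OF e] t s c by (auto simp: inner_diff_left)
          then have "y + (t - c) *\<^sub>R e \<in> cbox a b"
            using ye e by (auto simp: mem_box inner_add_left inner_Basis)
          then show ?thesis ..
        qed
        then obtain K m where "K \<in> C" "m \<in> {0, c}" "y + (t - m) *\<^sub>R e \<in> K"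
          using Union_cells by blast
        then show "t \<in> (\<Union>i\<in>C \<times> {0, c}. U i)"
          by (intro UN_I[of "(K, m)"]) (auto simp: U_def)
      qed
    qed
    from lipschitz_onD[OF this, of s 0] s show ?thesis
      by (simp add: dist_real_def)
  qed
  then show thesis using M0 that by blast
qed

text \<open>
  Integration by parts in the direction \<open>e\<close> against a coefficient that is constant along \<open>e\<close>: the
  integrals of the difference quotients vanish since shifting a periodic function does not change its
  integral, and the difference quotients converge almost everywhere, dominated by the Lipschitz
  bound.
\<close>

lemma integral_derivative_periodic:
  assumes e: "e \<in> Basis" and c: "c = (b - a) \<bullet> e" and c0: "0 < c"
    and per: "\<And>y. w (y + c *\<^sub>R e) = w y"
    and poly: "\<And>K. K \<in> C \<Longrightarrow> \<exists>G. real_polynomial_function G \<and> (\<forall>y\<in>K. w y = G y)"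
    and g: "piecewise_poly C g" and g_const: "\<And>y s. g (y + s *\<^sub>R e) = g y"
  shows "integral (cbox a b) (\<lambda>y. g y * frechet_derivative w (at y) e) = 0"
proof -
  obtain M where M: "0 \<le> M"
    "\<And>y s. y \<in> cbox a b \<Longrightarrow> 0 \<le> s \<Longrightarrow> s \<le> c \<Longrightarrow> \<bar>w (y + s *\<^sub>R e) - w y\<bar> \<le> M * s"
    by (rule lipschitz_in_direction[OF e c per poly]) blast+
  have w: "piecewise_poly C w"
    unfolding piecewise_poly_def using poly interior_subset by (meson subsetD)
  define s where "s k = c / real (Suc k)" for k
  have s: "0 < s k" "s k \<le> c" for k
    using c0 by (simp_all add: s_def divide_le_eq)
  define f where "f k y = g y * ((w (y + s k *\<^sub>R e) - w y) / s k)" for k y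
  define N where "N = (\<Union>K\<in>C. frontier K)"
  \<comment> \<open>On the cell faces \<open>w\<close> need not be differentiable.\<close>
  define S where "S = cbox a b - N"
  have N: "negligible N" unfolding N_def by (rule negligible_cell_faces)
  have on_S: "(h has_integral I) S \<longleftrightarrow> (h has_integral I) (cbox a b)" for h :: "'a \<Rightarrow> real" and I
    unfolding S_def by (rule has_integral_spike_set_eq; rule negligible_subset[OF N]) auto
  have gw: "(\<lambda>y. g y * w y) integrable_on cbox a b"
    using piecewise_poly_integrable[OF piecewise_poly_mult[OF g w]] set_lebesgue_integral_eq_integral(1) by blast
  have f0: "(f k has_integral 0) S" for k
  proof -
    have "((\<lambda>y. g (y + s k *\<^sub>R e) * w (y + s k *\<^sub>R e)) has_integral integral (cbox a b) (\<lambda>y. g y * w y)) (cbox a b)"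
      using has_integral_periodic_shift[OF e c less_imp_le[OF s(1)] s(2) _ gw] per g_const by simp
    then have "((\<lambda>y. (g (y + s k *\<^sub>R e) * w (y + s k *\<^sub>R e) - g y * w y) * (1 / s k)) has_integral
        (integral (cbox a b) (\<lambda>y. g y * w y) - integral (cbox a b) (\<lambda>y. g y * w y)) * (1 / s k)) (cbox a b)"
      by (intro has_integral_mult_left has_integral_diff integrable_integral gw)
    then show ?thesis
      by (simp add: on_S f_def[abs_def] g_const right_diff_distrib)
  qed
  have g_abs: "(\<lambda>y. \<bar>g y\<bar> * M) integrable_on S"
  proof -
    have "(\<lambda>y. \<bar>g y\<bar>) integrable_on cbox a b"
      using piecewise_poly_integrable[OF g] by (simp add: absolutely_integrable_on_def)
    then have "(\<lambda>y. \<bar>g y\<bar> * M) integrable_on cbox a b"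
      by (rule integrable_on_mult_left)
    then show ?thesis by (simp add: integrable_on_def on_S)
  qed
  have bound: "norm (f k y) \<le> \<bar>g y\<bar> * M" if "y \<in> S" for k y
  proof -
    have "\<bar>w (y + s k *\<^sub>R e) - w y\<bar> \<le> M * s k"
      using that M(2) s[of k] by (simp add: S_def)
    then have "\<bar>(w (y + s k *\<^sub>R e) - w y) / s k\<bar> \<le> M"
      using s[of k] by (simp add: abs_divide divide_le_eq)
    then have "\<bar>g y\<bar> * \<bar>(w (y + s k *\<^sub>R e) - w y) / s k\<bar> \<le> \<bar>g y\<bar> * M"
      by (rule mult_left_mono) simp
    then show ?thesis by (simp add: f_def abs_mult)
  qed
  have conv: "(\<lambda>k. f k y) \<longlonglongrightarrow> g y * frechet_derivative w (at y) e" if y: "y \<in> S" for y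
  proof -
    obtain K where "K \<in> C" "y \<in> interior K"
      using interior_of_cell y unfolding S_def N_def by blast
    then have D: "(w has_derivative frechet_derivative w (at y)) (at y)"
      using piecewise_poly_has_derivative[OF w] by blast
    have "((\<lambda>t. w (y + t *\<^sub>R e)) has_derivative (\<lambda>h. frechet_derivative w (at y) (h *\<^sub>R e))) (at 0)"
      by (rule has_derivative_compose[of "\<lambda>t. y + t *\<^sub>R e" "\<lambda>h. h *\<^sub>R e" 0 UNIV w])
         (use D in \<open>auto intro!: derivative_eq_intros\<close>)
    moreover have "(\<lambda>h. frechet_derivative w (at y) (h *\<^sub>R e)) = (*) (frechet_derivative w (at y) e)"
      using linear_scale[OF has_derivative_linear[OF D]] by (simp add: fun_eq_iff)
    ultimately have "((\<lambda>t. w (y + t *\<^sub>R e)) has_real_derivative frechet_derivative w (at y) e) (at 0)"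
      by (simp add: has_field_derivative_def)
    then have "((\<lambda>h. (w (y + h *\<^sub>R e) - w y) / h) \<longlongrightarrow> frechet_derivative w (at y) e) (at 0)"
      by (simp add: DERIV_def)
    moreover have "s \<longlonglongrightarrow> 0"
      unfolding s_def by (rule LIMSEQ_Suc[OF lim_const_over_n])
    then have "filterlim s (at 0) sequentially"
      using s by (auto simp: filterlim_at intro!: always_eventually less_imp_neq[symmetric])
    ultimately have "(\<lambda>k. (w (y + s k *\<^sub>R e) - w y) / s k) \<longlonglongrightarrow> frechet_derivative w (at y) e"
      by (rule filterlim_compose)
    then show ?thesis unfolding f_def by (rule tendsto_mult_left)
  qed
  have "(\<lambda>k. integral S (f k)) \<longlonglongrightarrow> integral S (\<lambda>y. g y * frechet_derivative w (at y) e)"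
    by (rule dominated_convergence(2)[OF _ g_abs bound conv]) (use f0 in \<open>auto simp: integrable_on_def\<close>)
  moreover have "integral S (f k) = 0" for k
    using f0 by (rule integral_unique)
  ultimately have "integral S (\<lambda>y. g y * frechet_derivative w (at y) e) = 0"
    by (simp add: LIMSEQ_const_iff)
  moreover have "integral S h = integral (cbox a b) h" for h :: "'a \<Rightarrow> real"
    unfolding integral_def integrable_on_def on_S by simp
  ultimately show ?thesis by simp
qed

end

section \<open>The tensor product space\<close>

lemma cross3_components:
  "cross3 p q $ m = (if m = 1 then p $ 2 * q $ 3 - p $ 3 * q $ 2
    else if m = 2 then p $ 3 * q $ 1 - p $ 1 * q $ 3 else p $ 1 * q $ 2 - p $ 2 * q $ 1)"
  using exhaust_3[of m] by (auto simp: cross3_def)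

lemma cross3_axis_component: "cross3 (axis m r) q $ m = 0"
  using exhaust_3[of m] by (auto simp: cross3_components axis_def)

lemma advect_eq_sum:
  "advect \<beta> w y = (\<Sum>e\<in>Basis. (\<beta> y \<bullet> e) * frechet_derivative w (at y) e)"
  by (simp add: advect_def grad_def inner_sum_right mult.commute)

text \<open>
  The tensor product of two nodal multilinear spaces. Degree of freedom \<open>k\<close> belongs to the pair
  \<open>(x_index k, v_index k)\<close>.
\<close>

locale phase_space_fe =
  X: q1_basis ax bx Tx X + V: q1_basis av bv Tv V
  for ax bx :: "real^'x" and Tx X and av bv :: "real^'v" and Tv V +
  fixes W :: "((real^'x) \<times> (real^'v)) fe_space"
  assumes W: "W = tensor_fe X V"
begin

abbreviation "W_dofs \<equiv> {1..ndof W}"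

definition x_index :: "nat \<Rightarrow> nat" where "x_index k = (k - 1) div ndof V + 1"
definition v_index :: "nat \<Rightarrow> nat" where "v_index k = (k - 1) mod ndof V + 1"

lemma bij_betw_indices: "bij_betw (\<lambda>k. (x_index k, v_index k)) W_dofs (X.dofs \<times> V.dofs)"
proof (rule bij_betw_byWitness[where f' = "\<lambda>(i, j). (i - 1) * ndof V + (j - 1) + 1"])
  have pos: "0 < ndof V" if "k \<in> W_dofs" for k
    using that by (cases "ndof V = 0") (auto simp: W tensor_fe_def)
  show "\<forall>k\<in>W_dofs. (case (x_index k, v_index k) of (i, j) \<Rightarrow> (i - 1) * ndof V + (j - 1) + 1) = k"
    by (auto simp: x_index_def v_index_def)
  show "\<forall>p\<in>X.dofs \<times> V.dofs. (x_index (case p of (i, j) \<Rightarrow> (i - 1) * ndof V + (j - 1) + 1),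
      v_index (case p of (i, j) \<Rightarrow> (i - 1) * ndof V + (j - 1) + 1)) = p"
  proof clarify
    fix i j assume i: "i \<in> X.dofs" and j: "j \<in> V.dofs"
    then obtain i' where i': "i = Suc i'" by (cases i) auto
    obtain j' where j': "j = Suc j'" "j' < ndof V" using j by (cases j) auto
    show "x_index ((i - 1) * ndof V + (j - 1) + 1) = i \<and> v_index ((i - 1) * ndof V + (j - 1) + 1) = j"
      using i' j' by (simp add: x_index_def v_index_def)
  qed
  show "(\<lambda>k. (x_index k, v_index k)) ` W_dofs \<subseteq> X.dofs \<times> V.dofs"
  proof
    fix p assume "p \<in> (\<lambda>k. (x_index k, v_index k)) ` W_dofs"
    then obtain k where k: "k \<in> W_dofs" "p = (x_index k, v_index k)" by blast
    have "k - 1 < ndof X * ndof V" using k by (auto simp: W tensor_fe_def)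
    then have "(k - 1) div ndof V < ndof X" by (rule less_mult_imp_div_less)
    moreover have "(k - 1) mod ndof V < ndof V" using pos[OF k(1)] by simp
    ultimately show "p \<in> X.dofs \<times> V.dofs" using k by (auto simp: x_index_def v_index_def)
  qed
  show "(\<lambda>(i, j). (i - 1) * ndof V + (j - 1) + 1) ` (X.dofs \<times> V.dofs) \<subseteq> W_dofs"
  proof clarify
    fix i j assume i: "i \<in> X.dofs" and j: "j \<in> V.dofs"
    then obtain i' where i': "i = Suc i'" "i' < ndof X" by (cases i) auto
    obtain j' where j': "j = Suc j'" "j' < ndof V" using j by (cases j) auto
    have "i' * ndof V + j' < Suc i' * ndof V" using j' by simp
    also have "\<dots> \<le> ndof X * ndof V" using i' by (intro mult_le_mono1) simp
    finally show "(i - 1) * ndof V + (j - 1) + 1 \<in> W_dofs"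
      using i' j' by (simp add: W tensor_fe_def)
  qed
qed

lemma index_mem:
  assumes "k \<in> W_dofs"
  shows "x_index k \<in> X.dofs" "v_index k \<in> V.dofs"
  using bij_betwE[OF bij_betw_indices] assms by (auto simp del: atLeastAtMost_iff)

lemma shape_W: "shape W k y = shape X (x_index k) (fst y) * shape V (v_index k) (snd y)"
  by (simp add: W tensor_fe_def case_prod_unfold x_index_def v_index_def)

lemma node_W: "node W k = (node X (x_index k), node V (v_index k))"
  by (simp add: W tensor_fe_def x_index_def v_index_def)

lemma dom_W: "fe_dom W = cbox (ax, av) (bx, bv)"
  by (simp add: W tensor_fe_def X.dom_eq V.dom_eq cbox_Pair_eq)

lemma partition_of_unity_W: "(\<Sum>k\<in>W_dofs. shape W k y) = 1"
proof -
  define F where "F = (\<lambda>(i, j). shape X i (fst y) * shape V j (snd y))"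
  have "(\<Sum>k\<in>W_dofs. shape W k y) = (\<Sum>k\<in>W_dofs. F (x_index k, v_index k))"
    by (simp add: shape_W F_def)
  also have "\<dots> = (\<Sum>p\<in>X.dofs \<times> V.dofs. F p)"
    by (rule sum.reindex_bij_betw[OF bij_betw_indices])
  also have "\<dots> = (\<Sum>i\<in>X.dofs. shape X i (fst y)) * (\<Sum>j\<in>V.dofs. shape V j (snd y))"
    by (simp add: sum_product sum.cartesian_product F_def)
  finally show ?thesis
    by (simp only: X.partition_of_unity V.partition_of_unity mult_1)
qed

lemma shape_W_nonneg: "k \<in> W_dofs \<Longrightarrow> 0 \<le> shape W k y"
  unfolding shape_W by (intro mult_nonneg_nonneg X.shape_nonneg V.shape_nonneg index_mem)

lemma shape_W_continuous:
  assumes k: "k \<in> W_dofs"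
  shows "continuous_on UNIV (shape W k)"
proof -
  have "continuous_on UNIV (\<lambda>y :: (real^'x) \<times> (real^'v). shape X (x_index k) (fst y))"
    by (rule continuous_on_compose2[OF X.shape_continuous[OF index_mem(1)[OF k]] continuous_on_fst[OF continuous_on_id]]) simp
  moreover have "continuous_on UNIV (\<lambda>y :: (real^'x) \<times> (real^'v). shape V (v_index k) (snd y))"
    by (rule continuous_on_compose2[OF V.shape_continuous[OF index_mem(2)[OF k]] continuous_on_snd[OF continuous_on_id]]) simp
  ultimately show ?thesis
    unfolding shape_W[abs_def] by (rule continuous_on_mult)
qed

lemma shape_W_node: "k \<in> W_dofs \<Longrightarrow> shape W k (node W k) = 1"
  unfolding shape_W node_W using index_mem[of k] by (simp add: X.shape_node V.shape_node)

lemma node_W_in_dom: "k \<in> W_dofs \<Longrightarrow> node W k \<in> cbox (ax, av) (bx, bv)"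
  unfolding node_W using index_mem[of k] X.node_in_dom V.node_in_dom by simp

lemma shape_W_periodic:
  assumes k: "k \<in> W_dofs" and e: "e \<in> Basis"
  shows "shape W k (y + (((bx, bv) - (ax, av)) \<bullet> e) *\<^sub>R e) = shape W k y"
proof -
  from e consider (x) j where "e = (axis j 1, 0)" | (v) j where "e = (0, axis j 1)"
    by (auto simp: Basis_prod_def Basis_vec_def)
  then show ?thesis
  proof cases
    case x
    then have "(((bx, bv) - (ax, av)) \<bullet> e) *\<^sub>R e = (axis j (bx $ j - ax $ j), 0)"
      by (simp add: inner_axis) (simp add: vec_eq_iff axis_def)
    then show ?thesis
      using X.shape_periodic[OF index_mem(1)[OF k] X.coordinate_period] by (simp add: shape_W)
  next
    case v
    then have "(((bx, bv) - (ax, av)) \<bullet> e) *\<^sub>R e = (0, axis j (bv $ j - av $ j))"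
      by (simp add: inner_axis) (simp add: vec_eq_iff axis_def)
    then show ?thesis
      using V.shape_periodic[OF index_mem(2)[OF k] V.coordinate_period] by (simp add: shape_W)
  qed
qed

lemma stencil_subset: "stencil W k \<subseteq> W_dofs"
  by (auto simp: stencil_def)

lemma self_in_stencil:
  assumes k: "k \<in> W_dofs"
  shows "k \<in> stencil W k"
proof -
  have "node W k \<in> {y. shape W k y \<noteq> 0}" using shape_W_node[OF k] by simp
  then have "node W k \<in> closure {y. shape W k y \<noteq> 0}" by (rule subsetD[OF closure_subset])
  then show ?thesis using k by (simp add: stencil_def)
qed

text \<open>Two nodes are neighbours if and only if they share a cell of the torus.\<close>

lemma mem_stencil_iff:
  assumes k: "k \<in> W_dofs"
  shows "l \<in> stencil W k \<longleftrightarrow> l \<in> W_dofs \<and>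
    (\<exists>K\<in>Tx. X.touches (x_index k) K \<and> X.touches (x_index l) K) \<and>
    (\<exists>L\<in>Tv. V.touches (v_index k) L \<and> V.touches (v_index l) L)"
proof -
  have "{y. shape W k y \<noteq> 0} = {x. shape X (x_index k) x \<noteq> 0} \<times> {v. shape V (v_index k) v \<noteq> 0}"
    by (auto simp: shape_W)
  then show ?thesis
    using X.node_in_support_iff[OF index_mem(1)[OF k]] V.node_in_support_iff[OF index_mem(2)[OF k]]
    by (simp add: stencil_def closure_Times node_W)
qed

lemma stencil_sym: "k \<in> W_dofs \<Longrightarrow> l \<in> stencil W k \<Longrightarrow> k \<in> stencil W l"
  using mem_stencil_iff stencil_subset by blast

text \<open>The phase space mesh consists of the products of the cells of both meshes.\<close>

definition cells :: "((real^'x) \<times> (real^'v)) set set" where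
  "cells = (\<lambda>(K, L). K \<times> L) ` (Tx \<times> Tv)"

sublocale box_cover "(ax, av)" "(bx, bv)" cells
proof
  show "finite cells" using X.finite_mesh V.finite_mesh by (simp add: cells_def)
  have "\<Union>cells = \<Union>Tx \<times> \<Union>Tv" by (auto simp: cells_def)
  then show "\<Union>cells = cbox (ax, av) (bx, bv)"
    by (simp add: X.Union_mesh V.Union_mesh cbox_Pair_eq)
  fix P assume "P \<in> cells"
  then obtain K L where "K \<in> Tx" "L \<in> Tv" "P = K \<times> L" by (auto simp: cells_def)
  moreover obtain l u where "K = cbox l u" using X.cell_cbox[OF \<open>K \<in> Tx\<close>] by blast
  moreover obtain l' u' where "L = cbox l' u'" using V.cell_cbox[OF \<open>L \<in> Tv\<close>] by blast
  ultimately have "P = cbox (l, l') (u, u')" by (simp add: cbox_Pair_eq)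
  then show "\<exists>l u. P = cbox l u" by blast
qed

lemma shape_W_polynomial_on_cell:
  assumes k: "k \<in> W_dofs" and P: "P \<in> cells"
  shows "\<exists>G. real_polynomial_function G \<and> (\<forall>y\<in>P. shape W k y = G y)"
proof -
  obtain K L where KL: "K \<in> Tx" "L \<in> Tv" "P = K \<times> L" using P by (auto simp: cells_def)
  obtain c where c: "\<And>x. x \<in> K \<Longrightarrow> shape X (x_index k) x = (\<Sum>S\<in>UNIV. c S * (\<Prod>m\<in>S. x $ m))"
    using X.shape_q1_on[OF index_mem(1)[OF k] KL(1)] by (auto simp: q1_on_def)
  obtain d where d: "\<And>v. v \<in> L \<Longrightarrow> shape V (v_index k) v = (\<Sum>S\<in>UNIV. d S * (\<Prod>m\<in>S. v $ m))"
    using V.shape_q1_on[OF index_mem(2)[OF k] KL(2)] by (auto simp: q1_on_def)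
  have "bounded_linear (\<lambda>y :: (real^'x) \<times> (real^'v). fst y $ m)" for m
    using bounded_linear_compose[OF bounded_linear_vec_nth bounded_linear_fst] .
  moreover have "bounded_linear (\<lambda>y :: (real^'x) \<times> (real^'v). snd y $ m)" for m
    using bounded_linear_compose[OF bounded_linear_vec_nth bounded_linear_snd] .
  ultimately have "real_polynomial_function (\<lambda>y :: (real^'x) \<times> (real^'v).
      (\<Sum>S\<in>UNIV. c S * (\<Prod>m\<in>S. fst y $ m)) * (\<Sum>S\<in>UNIV. d S * (\<Prod>m\<in>S. snd y $ m)))"
    by (intro real_polynomial_function.intros(4) real_polynomial_function_sum real_polynomial_function_prod
          real_polynomial_function.intros(1,2)) auto
  then show ?thesis
  proof (intro exI conjI ballI)
    fix y assume "y \<in> P"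
    then have "fst y \<in> K" "snd y \<in> L" using KL(3) by auto
    then show "shape W k y = (\<Sum>S\<in>UNIV. c S * (\<Prod>m\<in>S. fst y $ m)) * (\<Sum>S\<in>UNIV. d S * (\<Prod>m\<in>S. snd y $ m))"
      by (simp only: shape_W c d)
  qed
qed

lemma piecewise_poly_shape_W:
  assumes k: "k \<in> W_dofs"
  shows "piecewise_poly cells (shape W k)"
  unfolding piecewise_poly_def
proof
  fix P assume "P \<in> cells"
  then obtain G where "real_polynomial_function G" "\<forall>y\<in>P. shape W k y = G y"
    using shape_W_polynomial_on_cell[OF k] by blast
  then show "\<exists>G. real_polynomial_function G \<and> (\<forall>y\<in>interior P. shape W k y = G y)"
    using interior_subset[of P] by blast
qed

lemma piecewise_poly_field:
  fixes F :: "real^'x \<Rightarrow> real^'m"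
  assumes F: "piecewise_polynomial Tx F"
  shows "piecewise_poly cells (\<lambda>y. F (fst y) $ m)"
  unfolding piecewise_poly_def
proof
  fix P assume "P \<in> cells"
  then obtain K L where KL: "K \<in> Tx" "L \<in> Tv" "P = K \<times> L" by (auto simp: cells_def)
  obtain p where p: "polynomial_function p" "\<forall>x\<in>interior K. F x = p x"
    using F KL(1) by (auto simp: piecewise_polynomial_def)
  have "real_polynomial_function ((\<lambda>v. v $ m) \<circ> p)"
    using p(1) bounded_linear_vec_nth by (auto simp: polynomial_function_def)
  then have "real_polynomial_function (((\<lambda>v. v $ m) \<circ> p) \<circ> (fst :: (real^'x) \<times> (real^'v) \<Rightarrow> real^'x))"
    using polynomial_function_bounded_linear[OF bounded_linear_fst] by (rule real_polynomial_function_compose[rotated])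
  then show "\<exists>G. real_polynomial_function G \<and> (\<forall>y\<in>interior P. F (fst y) $ m = G y)"
    using p(2) by (intro exI conjI) (auto simp: KL interior_Times)
qed

lemma piecewise_poly_snd: "piecewise_poly cells (\<lambda>y. snd y $ m)"
  unfolding piecewise_poly_def
  using bounded_linear_compose[OF bounded_linear_vec_nth bounded_linear_snd] real_polynomial_function.intros(1) by blast

section \<open>Lumped masses\<close>

lemma mass_has_integral:
  assumes "i \<in> W_dofs" "j \<in> W_dofs"
  shows "((\<lambda>y. shape W j y * shape W i y) has_integral mass W i j) (cbox (ax, av) (bx, bv))"
proof -
  have "(\<lambda>y. shape W j y * shape W i y) absolutely_integrable_on cbox (ax, av) (bx, bv)"
    using assms by (intro piecewise_poly_integrable piecewise_poly_mult piecewise_poly_shape_W)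
  then show ?thesis
    using set_lebesgue_integral_eq_integral[of "cbox (ax, av) (bx, bv)" "\<lambda>y. shape W j y * shape W i y"]
    by (simp add: mass_def l2_def dom_W has_integral_iff)
qed

lemma mass_nonneg:
  assumes "i \<in> W_dofs" "j \<in> W_dofs"
  shows "0 \<le> mass W i j"
  using mass_has_integral[OF assms] by (rule has_integral_nonneg) (intro mult_nonneg_nonneg shape_W_nonneg assms)

lemma mass_diagonal_pos:
  assumes i: "i \<in> W_dofs"
  shows "0 < mass W i i"
proof -
  have "mass W i i \<noteq> 0"
  proof
    assume 0: "mass W i i = 0"
    have "box (ax, av) (bx, bv) \<noteq> {}"
      using X.box_nondegenerate V.box_nondegenerate
      by (auto simp: box_ne_empty Basis_prod_def Basis_vec_def inner_axis)
    then have "shape W i (node W i) * shape W i (node W i) = 0"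
      using has_integral_0_cbox_imp_0[of "(ax, av)" "(bx, bv)" "\<lambda>y. shape W i y * shape W i y" "node W i"]
        mass_has_integral[OF i i] 0 node_W_in_dom[OF i] continuous_on_subset[OF shape_W_continuous[OF i]]
      by (auto intro!: continuous_on_mult)
    then show False using shape_W_node[OF i] by simp
  qed
  then show ?thesis using mass_nonneg[OF i i] by simp
qed

lemma lumped_mass_pos:
  assumes i: "i \<in> W_dofs"
  shows "0 < lumped_mass W i"
  unfolding lumped_mass_def
proof (rule sum_pos2[of _ i])
  show "finite (stencil W i)" using stencil_subset finite_subset by blast
  show "i \<in> stencil W i" using self_in_stencil[OF i] .
  show "0 < mass W i i" using mass_diagonal_pos[OF i] .
  show "0 \<le> mass W i j" if "j \<in> stencil W i" for j
    using mass_nonneg[OF i] that stencil_subset by blast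
qed

end

section \<open>Row and column sums of the convection matrix\<close>

locale phase_space_advection = phase_space_fe ax bx Tx X av bv Tv V W
  for ax bx :: "real^'x" and Tx X and av bv :: "real^'v" and Tv V W +
  fixes \<sigma> :: "'x \<Rightarrow> 'v" and \<iota> :: "'v \<Rightarrow> 3" and E :: "real^'x \<Rightarrow> real^'v" and B :: "real^'x \<Rightarrow> real^3"
    and \<beta> :: "(real^'x) \<times> (real^'v) \<Rightarrow> (real^'x) \<times> (real^'v)"
  assumes E: "piecewise_polynomial Tx E" and B: "piecewise_polynomial Tx B"
    and \<beta>: "\<beta> = phase_velocity \<sigma> \<iota> E B"
begin

abbreviation "\<Omega> \<equiv> cbox (ax, av) (bx, bv)"

lemma velocity_component:
  "\<beta> y \<bullet> (axis k 1, 0) = snd y $ \<sigma> k"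
  "\<beta> y \<bullet> (0, axis j 1) = E (fst y) $ j + cross3 (embed3 \<iota> (snd y)) (B (fst y)) $ \<iota> j"
  by (simp_all add: \<beta> phase_velocity_def case_prod_unfold inner_axis)

lemma piecewise_poly_velocity:
  assumes "e \<in> Basis"
  shows "piecewise_poly cells (\<lambda>y. \<beta> y \<bullet> e)"
proof -
  have "piecewise_poly cells (\<lambda>y. embed3 \<iota> (snd y) $ m)" for m
    unfolding embed3_def by (simp, intro piecewise_poly_sum piecewise_poly_mult piecewise_poly_snd piecewise_poly_const)
  then have cross: "piecewise_poly cells (\<lambda>y. cross3 (embed3 \<iota> (snd y)) (B (fst y)) $ m)" for m
    using exhaust_3[of m] piecewise_poly_field[OF B]
    by (auto simp: cross3_components intro!: piecewise_poly_diff piecewise_poly_mult)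
  from assms consider (x) k where "e = (axis k 1, 0)" | (v) k where "e = (0, axis k 1)"
    by (auto simp: Basis_prod_def Basis_vec_def)
  then show ?thesis
  proof cases
    case x
    then show ?thesis by (simp only: velocity_component piecewise_poly_snd)
  next
    case v
    then show ?thesis
      by (simp only: velocity_component) (intro piecewise_poly_add piecewise_poly_field[OF E] cross)
  qed
qed

text \<open>
  No velocity component depends on its own coordinate; this is the form in which the vanishing
  divergence is used.
\<close>

lemma velocity_component_const:
  assumes "e \<in> Basis"
  shows "\<beta> (y + s *\<^sub>R e) \<bullet> e = \<beta> y \<bullet> e"
proof -
  have embed: "embed3 \<iota> (v + s *\<^sub>R axis k 1) = embed3 \<iota> v + axis (\<iota> k) s" for v k
  proof -
    have "(\<Sum>j\<in>UNIV. (s * axis k 1 $ j) *\<^sub>R axis (\<iota> j) (1::real)) = (\<Sum>j\<in>UNIV. if j = k then axis (\<iota> k) s else 0)"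
      by (intro sum.cong) (auto simp: axis_def vec_eq_iff)
    then show ?thesis
      by (simp add: embed3_def scaleR_add_left sum.distrib)
  qed
  from assms consider (x) k where "e = (axis k 1, 0)" | (v) k where "e = (0, axis k 1)"
    by (auto simp: Basis_prod_def Basis_vec_def)
  then show ?thesis
    by cases (simp_all add: velocity_component embed cross_add_left cross3_axis_component)
qed

lemma piecewise_poly_advect:
  "piecewise_poly cells w \<Longrightarrow> piecewise_poly cells (advect \<beta> w)"
  unfolding advect_eq_sum[abs_def]
  by (intro piecewise_poly_sum piecewise_poly_mult piecewise_poly_velocity piecewise_poly_frechet_derivative)

text \<open>
  The directional parts vanish separately, because each velocity component is constant along its own
  coordinate.
\<close>

lemma integral_advect_shape:
  assumes k: "k \<in> W_dofs"
  shows "integral \<Omega> (advect \<beta> (shape W k)) = 0"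
proof -
  have "integral \<Omega> (advect \<beta> (shape W k)) =
      (\<Sum>e\<in>Basis. integral \<Omega> (\<lambda>y. (\<beta> y \<bullet> e) * frechet_derivative (shape W k) (at y) e))"
    unfolding advect_eq_sum[abs_def]
  proof (rule integral_sum)
    fix e :: "(real^'x) \<times> (real^'v)" assume "e \<in> Basis"
    then show "(\<lambda>y. (\<beta> y \<bullet> e) * frechet_derivative (shape W k) (at y) e) integrable_on \<Omega>"
      by (intro set_lebesgue_integral_eq_integral(1) piecewise_poly_integrable piecewise_poly_mult
            piecewise_poly_velocity piecewise_poly_frechet_derivative piecewise_poly_shape_W k)
  qed simp
  also have "\<dots> = 0"
  proof (rule sum.neutral, rule ballI)
    fix e :: "(real^'x) \<times> (real^'v)" assume e: "e \<in> Basis"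
    have "0 < ((bx, bv) - (ax, av)) \<bullet> e"
      using e X.box_nondegenerate V.box_nondegenerate by (auto simp: Basis_prod_def Basis_vec_def inner_axis)
    then show "integral \<Omega> (\<lambda>y. (\<beta> y \<bullet> e) * frechet_derivative (shape W k) (at y) e) = 0"
      using integral_derivative_periodic[OF e refl _ shape_W_periodic[OF k e] shape_W_polynomial_on_cell[OF k]
          piecewise_poly_velocity[OF e] velocity_component_const[OF e]]
      by simp
  qed
  finally show ?thesis .
qed

lemma conv_has_integral:
  assumes "i \<in> W_dofs" "j \<in> W_dofs"
  shows "((\<lambda>y. advect \<beta> (shape W j) y * shape W i y) has_integral conv W \<beta> i j) \<Omega>"
proof -
  have "(\<lambda>y. advect \<beta> (shape W j) y * shape W i y) absolutely_integrable_on \<Omega>"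
    using assms by (intro piecewise_poly_integrable piecewise_poly_mult piecewise_poly_advect piecewise_poly_shape_W)
  then show ?thesis
    using set_lebesgue_integral_eq_integral[of \<Omega> "\<lambda>y. advect \<beta> (shape W j) y * shape W i y"]
    by (simp add: conv_def l2_def dom_W has_integral_iff)
qed

lemma sum_advect_shape:
  assumes y: "y \<in> \<Omega> - (\<Union>P\<in>cells. frontier P)"
  shows "(\<Sum>k\<in>W_dofs. advect \<beta> (shape W k) y) = 0"
proof -
  obtain P where P: "P \<in> cells" "y \<in> interior P" by (rule interior_of_cell[OF y])
  have "((\<lambda>y. \<Sum>k\<in>W_dofs. shape W k y) has_derivative
      (\<lambda>h. \<Sum>k\<in>W_dofs. frechet_derivative (shape W k) (at y) h)) (at y)"
    by (intro has_derivative_sum piecewise_poly_has_derivative[OF piecewise_poly_shape_W P])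
  then have "((\<lambda>y. 1) has_derivative (\<lambda>h. \<Sum>k\<in>W_dofs. frechet_derivative (shape W k) (at y) h)) (at y)"
    by (simp only: partition_of_unity_W)
  then have "(\<lambda>h. \<Sum>k\<in>W_dofs. frechet_derivative (shape W k) (at y) h) = (\<lambda>h. 0)"
    by (rule has_derivative_unique) simp
  then have "(\<Sum>k\<in>W_dofs. frechet_derivative (shape W k) (at y) e) = 0" for e
    by meson
  then have "(\<Sum>e\<in>Basis. (\<beta> y \<bullet> e) * (\<Sum>k\<in>W_dofs. frechet_derivative (shape W k) (at y) e)) = 0"
    by simp
  then show ?thesis
    unfolding advect_eq_sum sum_distrib_left by (subst sum.swap)
qed

text \<open>
  The two nodes share no cell. Hence one of the functions \<open>\<psi>\<^sub>k\<close> and \<open>\<psi>\<^sub>l\<close> vanishes identically on each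
  cell, and \<open>\<psi>\<^sub>l\<close> has a zero gradient in the interior in the second case.
\<close>

lemma conv_zero_off_stencil:
  assumes k: "k \<in> W_dofs" and l: "l \<in> W_dofs" and n: "l \<notin> stencil W k"
  shows "conv W \<beta> k l = 0"
proof -
  have "advect \<beta> (shape W l) y * shape W k y = 0" if y: "y \<in> \<Omega> - (\<Union>P\<in>cells. frontier P)" for y
  proof (cases "shape W k y = 0")
    case False
    obtain P where P: "P \<in> cells" "y \<in> interior P" by (rule interior_of_cell[OF y])
    then obtain K L where KL: "K \<in> Tx" "L \<in> Tv" "P = K \<times> L" by (auto simp: cells_def)
    have y': "fst y \<in> K" "snd y \<in> L"
      using P(2) interior_subset[of P] KL(3) by auto
    have "X.touches (x_index k) K" "V.touches (v_index k) L"
      using False X.shape_zero_off_touched_cells[OF index_mem(1)[OF k] KL(1) y'(1)]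
        V.shape_zero_off_touched_cells[OF index_mem(2)[OF k] KL(2) y'(2)]
      by (auto simp: shape_W)
    then have off: "\<not> X.touches (x_index l) K \<or> \<not> V.touches (v_index l) L"
      using n l KL mem_stencil_iff[OF k, of l] by blast
    have zero: "shape W l z = 0" if "z \<in> P" for z
      using off that KL X.shape_zero_off_touched_cells[OF index_mem(1)[OF l] KL(1), of "fst z"]
        V.shape_zero_off_touched_cells[OF index_mem(2)[OF l] KL(2), of "snd z"]
      by (auto simp: shape_W)
    have "(shape W l has_derivative (\<lambda>h. 0)) (at y)"
      by (rule has_derivative_transform_within_open[OF has_derivative_const[where c = 0] open_interior P(2)])
         (metis zero interior_subset subsetD)
    then have "frechet_derivative (shape W l) (at y) = (\<lambda>h. 0)"
      by (rule frechet_derivative_at[symmetric])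
    then show ?thesis by (simp add: advect_eq_sum)
  qed simp
  then have "((\<lambda>y. advect \<beta> (shape W l) y * shape W k y) has_integral 0) \<Omega>"
    by (intro has_integral_spike[OF negligible_cell_faces _ has_integral_0]) auto
  then show ?thesis
    using conv_has_integral[OF k l] has_integral_unique by blast
qed

text \<open>
  The gradients of the shape functions add up to zero since the shape functions add up to one.
\<close>

lemma conv_row_sum:
  assumes i: "i \<in> W_dofs"
  shows "(\<Sum>j\<in>stencil W i. conv W \<beta> i j) = 0"
proof -
  have "(\<Sum>j\<in>stencil W i. conv W \<beta> i j) = (\<Sum>j\<in>W_dofs. conv W \<beta> i j)"
    by (rule sum.mono_neutral_left[OF _ stencil_subset]) (simp_all add: conv_zero_off_stencil i[simplified])
  also have "\<dots> = 0"
  proof (rule has_integral_unique)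
    show "((\<lambda>y. \<Sum>j\<in>W_dofs. advect \<beta> (shape W j) y * shape W i y) has_integral
        (\<Sum>j\<in>W_dofs. conv W \<beta> i j)) \<Omega>"
      by (intro has_integral_sum conv_has_integral i) auto
    show "((\<lambda>y. \<Sum>j\<in>W_dofs. advect \<beta> (shape W j) y * shape W i y) has_integral 0) \<Omega>"
    by (rule has_integral_spike[OF negligible_cell_faces _ has_integral_0])
       (simp only: sum_advect_shape mult_zero_left flip: sum_distrib_right)
  qed
  finally show ?thesis .
qed

text \<open>
  The shape functions add up to one, and the remaining integral of \<open>\<beta> \<bullet> \<nabla>\<psi>\<^sub>j\<close> vanishes by periodicity
  and since the velocity is divergence free.
\<close>

lemma conv_column_sum:
  assumes j: "j \<in> W_dofs"
  shows "(\<Sum>i\<in>stencil W j. conv W \<beta> i j) = 0"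
proof -
  have "(\<Sum>i\<in>stencil W j. conv W \<beta> i j) = (\<Sum>i\<in>W_dofs. conv W \<beta> i j)"
  proof (rule sum.mono_neutral_left[OF _ stencil_subset], simp, rule ballI)
    fix i assume i: "i \<in> W_dofs - stencil W j"
    then have "j \<notin> stencil W i" using stencil_sym[of i j] by auto
    then show "conv W \<beta> i j = 0" using conv_zero_off_stencil[of i j] j i by simp
  qed
  moreover have "((\<lambda>y. \<Sum>i\<in>W_dofs. advect \<beta> (shape W j) y * shape W i y) has_integral
      (\<Sum>i\<in>W_dofs. conv W \<beta> i j)) \<Omega>"
    by (intro has_integral_sum conv_has_integral j) auto
  then have "(advect \<beta> (shape W j) has_integral (\<Sum>i\<in>W_dofs. conv W \<beta> i j)) \<Omega>"
    by (simp only: partition_of_unity_W mult_1_right flip: sum_distrib_left)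
  ultimately show ?thesis
    using integral_advect_shape[OF j] by (simp add: integral_unique)
qed

end

section \<open>The discrete scheme\<close>

text \<open>
  The update moves \<open>x\<close> to a convex combination of \<open>x\<close> and the values \<open>y j\<close>, with weights \<open>w j / m\<close>.
\<close>

lemma convex_update_lower_bound:
  fixes m g x lo :: real
  assumes "\<And>j. j \<in> S \<Longrightarrow> 0 \<le> w j" "sum w S \<le> m" "0 < m"
    and update: "m * (g - x) = (\<Sum>j\<in>S. w j * (y j - x))"
    and lo: "lo \<le> x" "\<And>j. j \<in> S \<Longrightarrow> lo \<le> y j"
  shows "lo \<le> g"
proof -
  have "(\<Sum>j\<in>S. w j * (lo - x)) \<le> (\<Sum>j\<in>S. w j * (y j - x))"
    using assms by (intro sum_mono mult_left_mono) auto
  then have "sum w S * (lo - x) \<le> m * (g - x)"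
    by (simp add: update sum_distrib_right)
  moreover have "m * (lo - x) \<le> sum w S * (lo - x)"
    using assms by (intro mult_right_mono_neg) auto
  ultimately have "m * (lo - x) \<le> m * (g - x)" by linarith
  then show ?thesis using \<open>0 < m\<close> by simp
qed

lemma convex_update_upper_bound:
  fixes m g x hi :: real
  assumes w: "\<And>j. j \<in> S \<Longrightarrow> 0 \<le> w j" "sum w S \<le> m" "0 < m"
    and update: "m * (g - x) = (\<Sum>j\<in>S. w j * (y j - x))"
    and hi: "x \<le> hi" "\<And>j. j \<in> S \<Longrightarrow> y j \<le> hi"
  shows "g \<le> hi"
proof -
  have "m * (- g - - x) = - (m * (g - x))" by (simp add: algebra_simps)
  also have "\<dots> = (\<Sum>j\<in>S. w j * (- y j - - x))"
    unfolding update sum_negf[symmetric] by (intro sum.cong) (auto simp: algebra_simps)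
  finally have update': "m * (- g - - x) = (\<Sum>j\<in>S. w j * (- y j - - x))" .
  have "- hi \<le> - g"
    by (rule convex_update_lower_bound[OF _ w(2,3) update']) (use w(1) hi in auto)
  then show ?thesis by simp
qed

text \<open>
  The bound behind the limiter: the regularization \<open>\<epsilon>\<close> in the denominator only decreases the
  limiting factor.
\<close>

lemma limited_increment_le:
  fixes P \<epsilon> r t :: real
  assumes "0 \<le> t" "t \<le> min (\<bar>r\<bar> / (\<bar>P\<bar> + \<epsilon>)) 1" "0 \<le> \<epsilon>" "P \<noteq> 0"
  shows "t * \<bar>P\<bar> \<le> \<bar>r\<bar>"
proof -
  have "t * (\<bar>P\<bar> + \<epsilon>) \<le> \<bar>r\<bar>"
    using assms by (simp add: pos_le_divide_eq add_pos_nonneg)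
  moreover have "t * \<bar>P\<bar> \<le> t * (\<bar>P\<bar> + \<epsilon>)"
    using assms by (intro mult_left_mono) auto
  ultimately show ?thesis by linarith
qed

lemma mass_sym: "mass W i j = mass W j i"
  by (simp add: mass_def l2_def mult.commute)

lemma visc_low_off_diagonal: "j \<noteq> i \<Longrightarrow> visc_low W \<beta> i j = max \<bar>conv W \<beta> i j\<bar> \<bar>conv W \<beta> j i\<bar>"
  by (simp add: visc_low_def with_diagonal_def)

lemma visc_low_sym: "j \<noteq> i \<Longrightarrow> visc_low W \<beta> i j = visc_low W \<beta> j i"
  by (simp add: visc_low_off_diagonal max.commute)

lemma visc_high_sym:
  assumes "j \<noteq> i"
  shows "visc_high W W' Ih \<beta> f i j = visc_high W W' Ih \<beta> f j i"
proof -
  have "visc_res W W' Ih \<beta> f i j = visc_res W W' Ih \<beta> f j i"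
    by (simp add: visc_res_def mass_sym[of W i j] max.commute)
  then show ?thesis
    using assms visc_low_sym[OF assms, of W \<beta>] by (simp add: visc_high_def with_diagonal_def)
qed

lemma correction_antisym: "correction W W' Ih \<beta> \<tau> f fH i j = - correction W W' Ih \<beta> \<tau> f fH j i"
proof (cases "j = i")
  case False
  then show ?thesis
    using mass_sym[of W i j] visc_low_sym[OF False, of W \<beta>] visc_high_sym[OF False, of W W' Ih \<beta> f]
    by (simp add: correction_def algebra_simps)
qed (simp add: correction_def)

lemma limiter_sym: "limiter W f fL A i j = limiter W f fL A j i"
  by (simp add: limiter_def min.commute)

lemma finite_stencil: "finite (stencil W i)"
  by (simp add: stencil_def)

text \<open>
  The properties of the discretization that enter the limiting argument: symmetric stencils, positive
  lumped masses, and a convection matrix whose rows and columns sum to zero over the stencils.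
\<close>

locale conservative_stencil =
  fixes W :: "'a::euclidean_space fe_space" and \<beta> :: "'a \<Rightarrow> 'a"
  assumes self_mem: "i \<in> {1..ndof W} \<Longrightarrow> i \<in> stencil W i"
    and sym_mem: "i \<in> {1..ndof W} \<Longrightarrow> j \<in> stencil W i \<Longrightarrow> i \<in> stencil W j"
    and lumped_pos: "i \<in> {1..ndof W} \<Longrightarrow> 0 < lumped_mass W i"
    and row_sum: "i \<in> {1..ndof W} \<Longrightarrow> (\<Sum>j\<in>stencil W i. conv W \<beta> i j) = 0"
    and column_sum: "j \<in> {1..ndof W} \<Longrightarrow> (\<Sum>i\<in>stencil W j. conv W \<beta> i j) = 0"
begin

abbreviation "I \<equiv> {1..ndof W}"

lemma stencil_subset_dofs: "stencil W i \<subseteq> I"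
  by (auto simp: stencil_def)

lemma sum_stencil_swap:
  "(\<Sum>i\<in>I. \<Sum>j\<in>stencil W i. F i j) = (\<Sum>j\<in>I. \<Sum>i\<in>stencil W j. F i j)"
proof -
  have "stencil W i = {j \<in> I. j \<in> stencil W i}" for i
    using stencil_subset_dofs by blast
  then have "(\<Sum>i\<in>I. \<Sum>j\<in>stencil W i. F i j) = (\<Sum>i\<in>I. \<Sum>j\<in>{j \<in> I. j \<in> stencil W i}. F i j)"
    by simp
  also have "\<dots> = (\<Sum>j\<in>I. \<Sum>i\<in>{i \<in> I. j \<in> stencil W i}. F i j)"
    by (rule sum.swap_restrict) simp_all
  also have "\<dots> = (\<Sum>j\<in>I. \<Sum>i\<in>stencil W j. F i j)"
  proof (rule sum.cong[OF refl])
    fix j assume "j \<in> I"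
    then have "{i \<in> I. j \<in> stencil W i} = stencil W j"
      using sym_mem stencil_subset_dofs[of j] by blast
    then show "(\<Sum>i\<in>{i \<in> I. j \<in> stencil W i}. F i j) = (\<Sum>i\<in>stencil W j. F i j)"
      by simp
  qed
  finally show ?thesis .
qed

lemma sum_stencil_antisym:
  fixes F :: "nat \<Rightarrow> nat \<Rightarrow> real"
  assumes "\<And>i j. F i j = - F j i"
  shows "(\<Sum>i\<in>I. \<Sum>j\<in>stencil W i. F i j) = 0"
proof -
  have "(\<Sum>i\<in>I. \<Sum>j\<in>stencil W i. F i j) = (\<Sum>j\<in>I. \<Sum>i\<in>stencil W j. F i j)"
    by (rule sum_stencil_swap)
  also have "\<dots> = (\<Sum>j\<in>I. \<Sum>i\<in>stencil W j. - F j i)"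
    by (intro sum.cong refl) (rule assms)
  also have "\<dots> = - (\<Sum>i\<in>I. \<Sum>j\<in>stencil W i. F i j)"
    by (simp add: sum_negf)
  finally show ?thesis by simp
qed

lemma sum_visc_low_eq_differences:
  assumes "i \<in> I"
  shows "(\<Sum>j\<in>stencil W i. visc_low W \<beta> i j * f j) = (\<Sum>j\<in>stencil W i - {i}. visc_low W \<beta> i j * (f j - f i))"
proof -
  have "visc_low W \<beta> i i = - (\<Sum>j\<in>stencil W i - {i}. visc_low W \<beta> i j)"
    unfolding visc_low_def by (subst with_diagonal_def) (auto simp: with_diagonal_def intro!: sum.cong)
  then show ?thesis
    using self_mem[OF assms]
    by (subst sum.remove[of _ i]) (auto simp: finite_stencil right_diff_distrib sum_subtractf sum_distrib_right)
qed

lemma sum_conv_eq_differences: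
  assumes "i \<in> I"
  shows "(\<Sum>j\<in>stencil W i. conv W \<beta> i j * f j) = (\<Sum>j\<in>stencil W i - {i}. conv W \<beta> i j * (f j - f i))"
proof -
  have "(\<Sum>j\<in>stencil W i. conv W \<beta> i j * f j) = (\<Sum>j\<in>stencil W i. conv W \<beta> i j * (f j - f i))"
    using row_sum[OF assms] by (simp add: right_diff_distrib sum_subtractf flip: sum_distrib_right)
  then show ?thesis
    using self_mem[OF assms] by (subst (asm) (2) sum.remove[of _ i]) (auto simp: finite_stencil)
qed

text \<open>
  Both parts hold at every node, also where the viscosity sum vanishes and the quotient in the CFL
  condition is infinite. The factor \<open>2\<close> comes from \<open>cfl \<le> 1/2\<close>.
\<close>

lemma cfl_time_step:
  assumes cfl: "0 < cfl" "cfl \<le> 1/2" "cfl_condition W \<beta> cfl \<tau>" and i: "i \<in> I"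
  shows "0 < \<tau>" "2 * \<tau> * (\<Sum>j\<in>stencil W i - {i}. visc_low W \<beta> i j) \<le> lumped_mass W i"
proof -
  define d where "d k = (\<Sum>j\<in>stencil W k - {k}. visc_low W \<beta> k j)" for k
  define q where "q k = ereal (lumped_mass W k) / ereal (d k)" for k
  have \<tau>: "ereal \<tau> = ereal cfl * Min (q ` I)"
    using cfl(3) by (simp add: cfl_condition_def q_def[abs_def] d_def)
  have d0: "0 \<le> d k" for k
    unfolding d_def by (intro sum_nonneg) (auto simp: visc_low_off_diagonal)
  have q0: "0 < q k" if "k \<in> I" for k
    using lumped_pos[OF that] d0[of k] by (cases "d k = 0") (auto simp: q_def)
  have "Min (q ` I) \<in> q ` I"
    using i by (intro Min_in) auto
  then have Min0: "0 < Min (q ` I)" using q0 by auto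
  then have "0 < ereal \<tau>" unfolding \<tau> using cfl(1) by (simp add: ereal_zero_less_0_iff)
  then show t0: "0 < \<tau>" by simp
  show "2 * \<tau> * (\<Sum>j\<in>stencil W i - {i}. visc_low W \<beta> i j) \<le> lumped_mass W i"
  proof (cases "d i = 0")
    case True
    then show ?thesis using lumped_pos[OF i] by (simp add: d_def)
  next
    case False
    then have di: "0 < d i" using d0[of i] by simp
    have "ereal \<tau> \<le> ereal cfl * q i"
      unfolding \<tau> using cfl(1) i by (intro ereal_mult_left_mono Min_le) auto
    also have "\<dots> = ereal (cfl * (lumped_mass W i / d i))"
      using di by (simp add: q_def)
    finally have "\<tau> \<le> cfl * (lumped_mass W i / d i)" by simp
    also have "\<dots> \<le> 1/2 * (lumped_mass W i / d i)"
      using cfl(2) di lumped_pos[OF i] by (intro mult_right_mono) auto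
    finally show ?thesis
      using di by (simp add: d_def[symmetric] field_simps)
  qed
qed

lemma low_order_increment:
  assumes low: "low_order_solution W \<beta> \<tau> f fL" and \<tau>: "0 < \<tau>" and i: "i \<in> I"
  shows "lumped_mass W i * (fL i - f i) =
    \<tau> * ((\<Sum>j\<in>stencil W i. visc_low W \<beta> i j * f j) - (\<Sum>j\<in>stencil W i. conv W \<beta> i j * f j))"
proof -
  have "lumped_mass W i * ((fL i - f i) / \<tau>) =
      (\<Sum>j\<in>stencil W i. visc_low W \<beta> i j * f j) - (\<Sum>j\<in>stencil W i. conv W \<beta> i j * f j)"
    using low i unfolding low_order_solution_def by fastforce
  then show ?thesis using \<tau> by (simp add: field_simps)
qed

lemma low_order_mass:
  assumes low: "low_order_solution W \<beta> \<tau> f fL" and \<tau>: "0 < \<tau>"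
  shows "(\<Sum>i\<in>I. lumped_mass W i * fL i) = (\<Sum>i\<in>I. lumped_mass W i * f i)"
proof -
  have "(\<Sum>i\<in>I. \<Sum>j\<in>stencil W i. conv W \<beta> i j * f j) = (\<Sum>j\<in>I. (\<Sum>i\<in>stencil W j. conv W \<beta> i j) * f j)"
    by (subst sum_stencil_swap) (simp add: sum_distrib_right)
  also have "\<dots> = 0"
    by (intro sum.neutral) (simp add: column_sum)
  finally have c: "(\<Sum>i\<in>I. \<Sum>j\<in>stencil W i. conv W \<beta> i j * f j) = 0" .
  have "(\<Sum>i\<in>I. \<Sum>j\<in>stencil W i. visc_low W \<beta> i j * f j) =
      (\<Sum>i\<in>I. \<Sum>j\<in>stencil W i. visc_low W \<beta> i j * (f j - f i))"
  proof (rule sum.cong[OF refl])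
    fix i assume i: "i \<in> I"
    show "(\<Sum>j\<in>stencil W i. visc_low W \<beta> i j * f j) = (\<Sum>j\<in>stencil W i. visc_low W \<beta> i j * (f j - f i))"
      unfolding sum_visc_low_eq_differences[OF i, of f] by (intro sum.mono_neutral_left finite_stencil) auto
  qed
  also have "\<dots> = 0"
  proof (rule sum_stencil_antisym)
    show "visc_low W \<beta> i j * (f j - f i) = - (visc_low W \<beta> j i * (f i - f j))" for i j
      using visc_low_sym[of j i W \<beta>] by (cases "j = i") (auto simp: algebra_simps)
  qed
  finally have "(\<Sum>i\<in>I. lumped_mass W i * (fL i - f i)) = 0"
    using c by (simp add: low_order_increment[OF low \<tau>] sum_subtractf flip: sum_distrib_left)
  then show ?thesis
    by (simp add: right_diff_distrib sum_subtractf)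
qed

text \<open>
  The weights \<open>\<tau> (d\<^sub>i\<^sub>j - c\<^sub>i\<^sub>j)\<close> are nonnegative as \<open>\<bar>c\<^sub>i\<^sub>j\<bar> \<le> d\<^sub>i\<^sub>j\<close>, and the CFL condition bounds their sum
  by \<open>m\<^sub>i\<close>.
\<close>

lemma low_order_bounds:
  assumes low: "low_order_solution W \<beta> \<tau> f fL" and \<tau>: "0 < \<tau>" and i: "i \<in> I"
    and cfl: "2 * \<tau> * (\<Sum>j\<in>stencil W i - {i}. visc_low W \<beta> i j) \<le> lumped_mass W i"
  shows "local_min W f i \<le> fL i" "fL i \<le> local_max W f i"
proof -
  define w where "w j = \<tau> * (visc_low W \<beta> i j - conv W \<beta> i j)" for j
  have abs_conv: "\<bar>conv W \<beta> i j\<bar> \<le> visc_low W \<beta> i j" if "j \<in> stencil W i - {i}" for j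
    using that by (simp add: visc_low_off_diagonal)
  have w: "0 \<le> w j" if "j \<in> stencil W i - {i}" for j
    using abs_conv[OF that] \<tau> by (simp add: w_def)
  have "sum w (stencil W i - {i}) \<le> (\<Sum>j\<in>stencil W i - {i}. \<tau> * (2 * visc_low W \<beta> i j))"
    unfolding w_def using abs_conv \<tau> by (intro sum_mono mult_left_mono) (force simp: abs_le_iff)+
  also have "\<dots> = 2 * \<tau> * (\<Sum>j\<in>stencil W i - {i}. visc_low W \<beta> i j)"
    by (simp add: sum_distrib_left mult_ac)
  finally have w_sum: "sum w (stencil W i - {i}) \<le> lumped_mass W i" using cfl by linarith
  have update: "lumped_mass W i * (fL i - f i) = (\<Sum>j\<in>stencil W i - {i}. w j * (f j - f i))"
    unfolding low_order_increment[OF low \<tau> i] sum_visc_low_eq_differences[OF i, of f] sum_conv_eq_differences[OF i, of f] w_def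
    by (simp add: sum_distrib_left algebra_simps sum_subtractf sum.distrib)
  have f: "local_min W f i \<le> f j" "f j \<le> local_max W f i" if "j \<in> stencil W i" for j
    using that by (auto simp: local_min_def local_max_def finite_stencil)
  show "local_min W f i \<le> fL i"
    by (rule convex_update_lower_bound[OF w w_sum lumped_pos[OF i] update]) (auto simp: f self_mem[OF i])
  show "fL i \<le> local_max W f i"
    by (rule convex_update_upper_bound[OF w w_sum lumped_pos[OF i] update]) (auto simp: f self_mem[OF i])
qed

text \<open>
  Every factor between \<open>0\<close> and the one-sided limiter keeps the individually limited update within the
  local bounds. This is applied with the symmetrized limiter, which may be smaller.
\<close>

lemma one_sided_limiter_bounds:
  assumes i: "i \<in> I" and fL: "local_min W f i \<le> fL i" "fL i \<le> local_max W f i"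
  shows "0 \<le> one_sided_limiter W f fL A i j"
    and "0 \<le> t \<Longrightarrow> t \<le> one_sided_limiter W f fL A i j \<Longrightarrow>
      local_min W f i \<le> fL i + t * scaled_correction W A i j \<and>
      fL i + t * scaled_correction W A i j \<le> local_max W f i"
proof -
  define P where "P = scaled_correction W A i j"
  define \<epsilon> where "\<epsilon> = 1 / 10 ^ 14 * Max ((\<lambda>k. \<bar>f k\<bar>) ` I)"
  define lo where "lo = local_min W f i"
  define hi where "hi = local_max W f i"
  have "\<bar>f i\<bar> \<le> Max ((\<lambda>k. \<bar>f k\<bar>) ` I)" using i by (intro Max_ge) auto
  then have \<epsilon>: "0 \<le> \<epsilon>" by (simp add: \<epsilon>_def)
  have l: "one_sided_limiter W f fL A i j =
      (if fL i + P < lo then min (\<bar>lo - fL i\<bar> / (\<bar>P\<bar> + \<epsilon>)) 1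
       else if fL i + P \<le> hi then 1 else min (\<bar>hi - fL i\<bar> / (\<bar>P\<bar> + \<epsilon>)) 1)"
    unfolding one_sided_limiter_def Let_def P_def \<epsilon>_def lo_def hi_def ..
  show "0 \<le> one_sided_limiter W f fL A i j"
    using \<epsilon> by (simp add: l)
  assume t: "0 \<le> t" "t \<le> one_sided_limiter W f fL A i j"
  have fL': "lo \<le> fL i" "fL i \<le> hi" using fL by (simp_all add: lo_def hi_def)
  consider (below) "fL i + P < lo" | (inside) "lo \<le> fL i + P" "fL i + P \<le> hi" | (above) "hi < fL i + P"
    by linarith
  then have "lo \<le> fL i + t * P \<and> fL i + t * P \<le> hi"
  proof cases
    case below
    then have "P < 0" using fL' by simp
    have "t \<le> min (\<bar>lo - fL i\<bar> / (\<bar>P\<bar> + \<epsilon>)) 1"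
      using t(2) below unfolding l by simp
    then have "t * \<bar>P\<bar> \<le> \<bar>lo - fL i\<bar>"
      using \<open>P < 0\<close> by (intro limited_increment_le[OF t(1) _ \<epsilon>]) auto
    moreover have "t * P \<le> 0" using t \<open>P < 0\<close> by (simp add: mult_nonneg_nonpos)
    ultimately show ?thesis using fL' \<open>P < 0\<close> by simp
  next
    case inside
    then have "t \<le> 1" using t by (simp add: l)
    have "fL i + t * P = (1 - t) * fL i + t * (fL i + P)" by (simp add: algebra_simps)
    moreover have "(1 - t) * lo + t * lo \<le> (1 - t) * fL i + t * (fL i + P)"
      using t \<open>t \<le> 1\<close> fL' inside by (intro add_mono mult_left_mono) auto
    moreover have "(1 - t) * fL i + t * (fL i + P) \<le> (1 - t) * hi + t * hi"
      using t \<open>t \<le> 1\<close> fL' inside by (intro add_mono mult_left_mono) auto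
    ultimately show ?thesis by (simp add: algebra_simps)
  next
    case above
    then have "0 < P" using fL' by simp
    have "t \<le> min (\<bar>hi - fL i\<bar> / (\<bar>P\<bar> + \<epsilon>)) 1"
      using t(2) above fL' unfolding l by simp
    then have "t * \<bar>P\<bar> \<le> \<bar>hi - fL i\<bar>"
      using \<open>0 < P\<close> by (intro limited_increment_le[OF t(1) _ \<epsilon>]) auto
    moreover have "0 \<le> t * P" using t \<open>0 < P\<close> by simp
    ultimately show ?thesis using fL' \<open>0 < P\<close> by simp
  qed
  then show "local_min W f i \<le> fL i + t * scaled_correction W A i j \<and>
      fL i + t * scaled_correction W A i j \<le> local_max W f i"
    by (simp add: P_def lo_def hi_def)
qed

text \<open>
  The limited solution is the mean of the individually limited updates \<open>y j\<close> over the neighbours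
  \<open>j \<noteq> i\<close>, since the scaled corrections carry the factor \<open>card (stencil W i) - 1\<close>. If there are no
  such neighbours, as on a mesh with a single cell, it is the low-order value.
\<close>

lemma limited_update_bounds:
  assumes i: "i \<in> I"
    and fL: "\<And>k. k \<in> I \<Longrightarrow> local_min W f k \<le> fL k" "\<And>k. k \<in> I \<Longrightarrow> fL k \<le> local_max W f k"
    and diagonal: "A i i = 0"
    and update: "lumped_mass W i * g = lumped_mass W i * fL i + (\<Sum>j\<in>stencil W i. limiter W f fL A i j * A i j)"
  shows "local_min W f i \<le> g" "g \<le> local_max W f i"
proof -
  define S where "S = stencil W i - {i}"
  define y where "y j = fL i + limiter W f fL A i j * scaled_correction W A i j" for j
  have "0 < card (stencil W i)"
    using self_mem[OF i] finite_stencil[of W i] by (auto simp: card_gt_0_iff)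
  then have card: "real (card (stencil W i)) - 1 = real (card S)"
    using self_mem[OF i] by (simp add: S_def card_Diff_singleton of_nat_diff Suc_leI)
  have y: "local_min W f i \<le> y j" "y j \<le> local_max W f i" if j: "j \<in> S" for j
  proof -
    have jI: "j \<in> I" using j stencil_subset_dofs[of i] unfolding S_def by blast
    have "0 \<le> limiter W f fL A i j" "limiter W f fL A i j \<le> one_sided_limiter W f fL A i j"
      unfolding limiter_def
      using one_sided_limiter_bounds(1)[where f = f and fL = fL, OF i fL[OF i], of A j]
        one_sided_limiter_bounds(1)[where f = f and fL = fL, OF jI fL[OF jI], of A i]
      by auto
    then show "local_min W f i \<le> y j" "y j \<le> local_max W f i"
      using one_sided_limiter_bounds(2)[where f = f and fL = fL, OF i fL[OF i]] by (auto simp: y_def)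
  qed
  have m: "0 < lumped_mass W i" by (rule lumped_pos[OF i])
  have "(\<Sum>j\<in>stencil W i. limiter W f fL A i j * A i j) = (\<Sum>j\<in>S. limiter W f fL A i j * A i j)"
    using self_mem[OF i] diagonal by (subst sum.remove[of _ i]) (auto simp: finite_stencil S_def)
  then have "lumped_mass W i * (g - fL i) = (\<Sum>j\<in>S. limiter W f fL A i j * A i j)"
    using update by (simp add: right_diff_distrib)
  then have "lumped_mass W i * (g - fL i) * real (card S) =
      (\<Sum>j\<in>S. limiter W f fL A i j * A i j * real (card S))"
    by (simp add: sum_distrib_right)
  also have "\<dots> = (\<Sum>j\<in>S. lumped_mass W i * (y j - fL i))"
    using m by (intro sum.cong refl) (simp add: y_def scaled_correction_def card field_simps)
  finally have "lumped_mass W i * (real (card S) * (g - fL i)) = lumped_mass W i * (\<Sum>j\<in>S. 1 * (y j - fL i))"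
    by (simp add: sum_distrib_left mult_ac)
  then have mean: "real (card S) * (g - fL i) = (\<Sum>j\<in>S. 1 * (y j - fL i))"
    using m by simp
  show "local_min W f i \<le> g" and "g \<le> local_max W f i"
  proof (atomize (full), cases "S = {}")
    case True
    then have "g = fL i"
      using \<open>lumped_mass W i * (g - fL i) = (\<Sum>j\<in>S. limiter W f fL A i j * A i j)\<close> m by simp
    then show "local_min W f i \<le> g \<and> g \<le> local_max W f i" using fL[OF i] by simp
  next
    case False
    then have "0 < real (card S)" by (simp add: S_def finite_stencil card_gt_0_iff)
    then show "local_min W f i \<le> g \<and> g \<le> local_max W f i"
      using convex_update_lower_bound[OF _ _ _ mean, of "local_min W f i"]
        convex_update_upper_bound[OF _ _ _ mean, of "local_max W f i"] y fL[OF i]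
      by simp
  qed
qed

lemma limited_update_mass:
  assumes antisym: "\<And>i j. A i j = - A j i"
    and update: "\<And>i. i \<in> I \<Longrightarrow> lumped_mass W i * g i =
      lumped_mass W i * fL i + (\<Sum>j\<in>stencil W i. limiter W f fL A i j * A i j)"
  shows "(\<Sum>i\<in>I. lumped_mass W i * g i) = (\<Sum>i\<in>I. lumped_mass W i * fL i)"
proof -
  have "limiter W f fL A i j * A i j = - (limiter W f fL A j i * A j i)" for i j
    using antisym[of i j] by (simp add: limiter_sym[of W f fL A i j])
  then have "(\<Sum>i\<in>I. \<Sum>j\<in>stencil W i. limiter W f fL A i j * A i j) = 0"
    by (rule sum_stencil_antisym)
  then show ?thesis
    by (simp add: update sum.distrib)
qed

end

theorem theorem3p2:
  fixes ax bx :: "real^'x" and av bv :: "real^'v"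
    and Tx Tx' :: "(real^'x) set set" and Tv Tv' :: "(real^'v) set set"
    and X X' :: "(real^'x) fe_space" and V V' :: "(real^'v) fe_space"
    and W W' :: "((real^'x) \<times> (real^'v)) fe_space"
    and \<sigma> :: "'x \<Rightarrow> 'v" and \<iota> :: "'v \<Rightarrow> 3"
    and E :: "real^'x \<Rightarrow> real^'v" and B :: "real^'x \<Rightarrow> real^3"
    and \<beta> :: "(real^'x) \<times> (real^'v) \<Rightarrow> (real^'x) \<times> (real^'v)"
    and Ih :: "((real^'x) \<times> (real^'v) \<Rightarrow> real) \<Rightarrow> (real^'x) \<times> (real^'v) \<Rightarrow> real"
    and f fL fH fnew :: "nat \<Rightarrow> real" and A :: "nat \<Rightarrow> nat \<Rightarrow> real"
    and \<tau> cfl :: real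
  assumes mesh: "periodic_cuboid_mesh ax bx Tx" "periodic_cuboid_mesh av bv Tv"
    and space: "q1_nodal ax bx Tx X" "q1_nodal av bv Tv V" "W = tensor_fe X V"
    and coarse_mesh: "periodic_cuboid_mesh ax bx Tx'" "periodic_cuboid_mesh av bv Tv'"
      "mesh_size Tx \<le> mesh_size Tx'" "mesh_size Tv \<le> mesh_size Tv'"
    and coarse_space: "q1_nodal ax bx Tx' X'" "q1_nodal av bv Tv' V'" "W' = tensor_fe X' V'"
    and interpolation:
      "linear_between (tensor_space (q1_space ax bx Tx') (q1_space av bv Tv'))
                      (tensor_space (q1_space ax bx Tx) (q1_space av bv Tv)) Ih"
    and coordinates: "inj \<sigma>" "inj \<iota>"
    and fields: "piecewise_polynomial Tx E" "piecewise_polynomial Tx B"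
    and velocity: "\<beta> = phase_velocity \<sigma> \<iota> E B"
    and nonzero: "fe_fun W f \<noteq> (\<lambda>y. 0)"
    and cfl: "0 < cfl" "cfl \<le> 1/2" "cfl_condition W \<beta> cfl \<tau>"
    and low: "low_order_solution W \<beta> \<tau> f fL"
    and high: "high_order_solution W W' Ih \<beta> \<tau> f fH"
    and A: "A = correction W W' Ih \<beta> \<tau> f fH"
    and update: "\<And>i. i \<in> {1..ndof W} \<Longrightarrow>
      lumped_mass W i * fnew i =
        lumped_mass W i * fL i + (\<Sum>j\<in>stencil W i. limiter W f fL A i j * A i j)"
  shows "(\<Sum>i=1..ndof W. lumped_mass W i * fnew i) = (\<Sum>i=1..ndof W. lumped_mass W i * f i) \<and>
         (\<forall>i\<in>{1..ndof W}. Min (f ` stencil W i) \<le> fnew i \<and> fnew i \<le> Max (f ` stencil W i))"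
proof -
  interpret phase_space_advection ax bx Tx X av bv Tv V W \<sigma> \<iota> E B \<beta>
    by unfold_locales (fact mesh space fields velocity)+
  interpret conservative_stencil W \<beta>
    by unfold_locales (fact self_in_stencil stencil_sym lumped_mass_pos conv_row_sum conv_column_sum)+
  have antisym: "A i j = - A j i" for i j
    unfolding A by (rule correction_antisym)
  show ?thesis
  proof (cases "ndof W = 0")
    \<comment> \<open>Without degrees of freedom the minimum in the CFL condition is unspecified.\<close>
    case False
    then have \<tau>: "0 < \<tau>" by (intro cfl_time_step(1)[OF cfl, of 1]) simp
    have fL: "local_min W f i \<le> fL i" "fL i \<le> local_max W f i" if "i \<in> {1..ndof W}" for i
      using low_order_bounds[OF low \<tau> that cfl_time_step(2)[OF cfl that]] by auto
    have "A i i = 0" for i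
      using antisym[of i i] by simp
    then have "local_min W f i \<le> fnew i \<and> fnew i \<le> local_max W f i" if "i \<in> {1..ndof W}" for i
      using limited_update_bounds[OF that fL _ update[OF that]] by simp
    moreover have "(\<Sum>i=1..ndof W. lumped_mass W i * fnew i) = (\<Sum>i=1..ndof W. lumped_mass W i * f i)"
      using limited_update_mass[OF antisym update] low_order_mass[OF low \<tau>] by simp
    ultimately show ?thesis
      by (simp add: local_min_def local_max_def)
  qed simp
qed

end
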